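(* Fix $r\in(0,1)$ and $q\in[0,1/2)$. For each number of blocks $m$, let an instance of the ARock iteration with $m$ blocks be given (as described in the context), driven by an $r$-Lipschitz operator $T$, and suppose that the block sequence $i(k)$ is IID uniform on $\{1,\dots,m\}$ with $i(k)$ independent of $\mathcal F^k$, and that the delay vectors $\vec j(0),\vec j(1),\dots$ are IID with $\vec j(k)$ independent of $\mathcal G^k$ (the space, the operator and the delay distribution may depend on $m$). Let $P_l=\mathbb P[j(k)\ge l]$, $\rho=1-\frac1m(1-r^2)$, and $$M_1=\sum_{l=1}^\infty P_l\,\rho^{-l/2},\qquad M_2=\sum_{l=1}^\infty P_l^{1/2}\rho^{-l/2},$$ and suppose that $M_1,M_2$ are finite and are $\mathcal O(m^q)$ as $m\to\infty$. Let the step size be constant, $$\eta^k=\eta_1:=\Big(1+m^{-1/2}\big((1-r^2)^{1/2}M_1+2M_2\big)\Big)^{-1}.$$ Then there exist positive coefficients $(c_i)_{i=1}^\infty$ (depending on $m$) such that the Lyapunov function $$\xi^k=\|x^k-x^*\|^2+\frac1m\sum_{i=1}^\infty c_i\|x^{k+1-i}-x^{k-i}\|^2$$ satisfies, for all $k$, $$\mathbb E[\xi^{k+1}\mid\mathcal G^k]\le R_m\,\xi^k,\qquad R_m=1-\frac1m(1-r^2)+\mathcal O\big(m^{q-3/2}\big),$$ and the corresponding epoch iteration complexity is $$I(\epsilon)=\big(1+\mathcal O(m^{-1/2+q})\big)\,\frac{1}{1-r^2}\,\ln(1/\epsilon),$$ as $m\to\infty$.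
   Context: ARock iteration. $\mathbb H=\mathbb H_1\times\cdots\times\mathbb H_m$ is $\mathbb R^N$ or a separable Hilbert space, decomposed into $m$ orthogonal subspaces; $x\in\mathbb H$ is written $x=(x_1,\dots,x_m)$. $T:\mathbb H\to\mathbb H$ is $r$-Lipschitz with $0<r<1$, $x^*$ is its fixed point, $S=I-T$, and $S_ix$ is the $i$-th block of $Sx$. Given a starting point $x^0\in\mathbb H$, step sizes $\eta^k$, random block indices $i(k)\in\{1,\dots,m\}$ and delay vectors $\vec j(k)=(j(k,1),\dots,j(k,m))\in\mathbb N^m$ (with $0\in\mathbb N$), the iterates are $$x_i^{k+1}=x_i^k-\eta^kS_i(\hat x^k)\ \text{ if } i=i(k),\qquad x_i^{k+1}=x_i^k\ \text{ if } i\ne i(k),$$ where $\hat x^k=(x_1^{k-j(k,1)},\dots,x_m^{k-j(k,m)})$ is the delayed iterate, with the convention $x^n=x^0$ for $n<0$. The current delay is $j(k)=\max_i j(k,i)$. The filtrations are $\mathcal F^k=\sigma(x^0,\dots,x^k,\vec j(0),\dots,\vec j(k))$ and $\mathcal G^k=\sigma(x^0,\dots,x^k)$. One epoch consists of $m$ iterations. The epoch iteration complexity $I(\epsilon)$ is the number of epochs needed to reduce the error below $\epsilon$ times its initial value; for a per-iteration linear rate $R$ it is the solution of $R^{\,m I(\epsilon)}=\epsilon$, $0<\epsilon<1$. *)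

theory Defs
  imports "HOL-Probability.Probability" "HOL-Library.Landau_Symbols"
begin

section \<open>Block decompositions\<close>

definition orthogonal_blocks :: "'a::real_inner set \<Rightarrow> nat \<Rightarrow> (nat \<Rightarrow> 'a set) \<Rightarrow> bool" where
  "orthogonal_blocks H m B \<longleftrightarrow>
     (\<forall>i\<in>{1..m}. subspace (B i) \<and> closed (B i)) \<and>
     (\<forall>i\<in>{1..m}. \<forall>l\<in>{1..m}. i \<noteq> l \<longrightarrow> (\<forall>u\<in>B i. \<forall>v\<in>B l. orthogonal u v)) \<and>
     H = {\<Sum>i=1..m. y i | y. \<forall>i\<in>{1..m}. y i \<in> B i}"

text \<open>The component \<open>x\<^sub>i\<close> of \<open>x = (x\<^sub>1, \<dots>, x\<^sub>m)\<close>, regarded as an element of the ambient space. It is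
  only meaningful for \<open>x\<close> in the space decomposed by \<open>B\<close> and \<open>i \<in> {1..m}\<close>; there the family is
  unique because the blocks are orthogonal.\<close>

definition block :: "nat \<Rightarrow> (nat \<Rightarrow> 'a::real_inner set) \<Rightarrow> nat \<Rightarrow> 'a \<Rightarrow> 'a" where
  "block m B i x = (THE y. y \<in> (\<Pi>\<^sub>E l\<in>{1..m}. B l) \<and> x = (\<Sum>l=1..m. y l)) i"


section \<open>The iteration\<close>

text \<open>Truncated subtraction on \<^typ>\<open>nat\<close> implements the convention \<open>x\<^sup>n = x\<^sup>0\<close> for \<open>n < 0\<close>, here and in
  the Lyapunov function below.\<close>

definition delayed_iterate ::
  "nat \<Rightarrow> (nat \<Rightarrow> 'a::real_inner set) \<Rightarrow> (nat \<Rightarrow> 'a) \<Rightarrow> (nat \<Rightarrow> nat) \<Rightarrow> nat \<Rightarrow> 'a" where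
  "delayed_iterate m B x d k = (\<Sum>i=1..m. block m B i (x (k - d i)))"

text \<open>The delay \<open>j(k,i)\<close> is the random variable \<open>j k i\<close>. Delay vectors are functions on \<open>{1..m}\<close>,
  extended by \<^const>\<open>undefined\<close> as the library's finite product spaces require.\<close>

definition delay_vec :: "nat \<Rightarrow> (nat \<Rightarrow> nat \<Rightarrow> 'w \<Rightarrow> nat) \<Rightarrow> nat \<Rightarrow> 'w \<Rightarrow> nat \<Rightarrow> nat" where
  "delay_vec m j k \<omega> = (\<lambda>i\<in>{1..m}. j k i \<omega>)"

abbreviation delay_space :: "nat \<Rightarrow> (nat \<Rightarrow> nat) measure" where
  "delay_space m \<equiv> PiM {1..m} (\<lambda>_. count_space UNIV)"

definition current_delay :: "nat \<Rightarrow> (nat \<Rightarrow> nat \<Rightarrow> 'w \<Rightarrow> nat) \<Rightarrow> nat \<Rightarrow> 'w \<Rightarrow> nat" where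
  "current_delay m j k \<omega> = Max ((\<lambda>i. j k i \<omega>) ` {1..m})"

definition G_filtration ::
  "'w measure \<Rightarrow> (nat \<Rightarrow> 'w \<Rightarrow> 'a::topological_space) \<Rightarrow> nat \<Rightarrow> 'w measure" where
  "G_filtration M x k = sigma (space M)
     (\<Union>n\<le>k. {x n -` A \<inter> space M | A. A \<in> sets borel})"

definition F_filtration ::
  "'w measure \<Rightarrow> nat \<Rightarrow> (nat \<Rightarrow> 'w \<Rightarrow> 'a::topological_space) \<Rightarrow> (nat \<Rightarrow> nat \<Rightarrow> 'w \<Rightarrow> nat)
     \<Rightarrow> nat \<Rightarrow> 'w measure" where
  "F_filtration M m x j k = sigma (space M)
     ((\<Union>n\<le>k. {x n -` A \<inter> space M | A. A \<in> sets borel}) \<union>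
      (\<Union>n\<le>k. {delay_vec m j n -` A \<inter> space M | A. A \<in> sets (delay_space m)}))"

text \<open>The space \<open>H\<close> is a closed subspace of an ambient separable Hilbert space, so that families of
  instances on different spaces can be considered. The starting point may be random.\<close>

locale arock = prob_space M
  for M :: "'w measure" +
  fixes m :: nat
    and H :: "'a::{real_inner, banach, second_countable_topology} set"
    and B :: "nat \<Rightarrow> 'a set"
    and r :: real
    and T :: "'a \<Rightarrow> 'a"
    and xs :: 'a
    and \<eta> :: "nat \<Rightarrow> real"
    and i :: "nat \<Rightarrow> 'w \<Rightarrow> nat"
    and j :: "nat \<Rightarrow> nat \<Rightarrow> 'w \<Rightarrow> nat"
    and x :: "nat \<Rightarrow> 'w \<Rightarrow> 'a"
  assumes m_pos: "1 \<le> m"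
    and blocks: "orthogonal_blocks H m B"
    and r_pos: "0 < r" and r_less_1: "r < 1"
    and T_maps: "T \<in> H \<rightarrow> H"
    and T_lipschitz: "r-lipschitz_on H T"
    and xs_in: "xs \<in> H" and xs_fixed: "T xs = xs"
    and i_measurable: "i k \<in> measurable M (count_space {1..m})"
    and j_measurable: "delay_vec m j k \<in> measurable M (delay_space m)"
    and x0_measurable: "x 0 \<in> borel_measurable M"
    and x_in: "\<omega> \<in> space M \<Longrightarrow> x k \<omega> \<in> H"
    and x_step: "\<omega> \<in> space M \<Longrightarrow> l \<in> {1..m} \<Longrightarrow>
      block m B l (x (Suc k) \<omega>) =
        (if l = i k \<omega>
         then block m B l (x k \<omega>) - \<eta> k *\<^sub>R
           (let xh = delayed_iterate m B (\<lambda>n. x n \<omega>) (\<lambda>a. j k a \<omega>) k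
            in block m B l (xh - T xh))
         else block m B l (x k \<omega>))"

locale arock_iid = arock +
  assumes i_indep: "indep_vars (\<lambda>_. count_space {1..m}) i UNIV"
    and i_uniform: "distr M (count_space {1..m}) (i k) = uniform_count_measure {1..m}"
    and i_indep_F: "indep_set (sets (vimage_algebra (space M) (i k) (count_space {1..m})))
                      (sets (F_filtration M m x j k))"
    and j_indep: "indep_vars (\<lambda>_. delay_space m) (delay_vec m j) UNIV"
    and j_ident: "distr M (delay_space m) (delay_vec m j k)
                    = distr M (delay_space m) (delay_vec m j 0)"
    and j_indep_G: "indep_set (sets (vimage_algebra (space M) (delay_vec m j k) (delay_space m)))
                      (sets (G_filtration M x k))"


section \<open>Lyapunov function and complexity\<close>

text \<open>Coefficients are indexed from 1. For a path \<open>x\<close> the series has finitely many nonzero terms,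
  since \<open>x\<^sup>n = x\<^sup>0\<close> for \<open>n < 0\<close>.\<close>

definition lyapunov ::
  "nat \<Rightarrow> (nat \<Rightarrow> real) \<Rightarrow> 'a::real_inner \<Rightarrow> (nat \<Rightarrow> 'a) \<Rightarrow> nat \<Rightarrow> real" where
  "lyapunov m c xs x k = (norm (x k - xs))\<^sup>2
     + 1 / real m * (\<Sum>i. c (Suc i) * (norm (x (k + 1 - Suc i) - x (k - Suc i)))\<^sup>2)"

text \<open>\<open>I\<close> epochs of \<open>m\<close> iterations at linear rate \<open>R\<close> reduce the error by the factor \<open>\<epsilon>\<close>.\<close>

definition is_epoch_complexity :: "real \<Rightarrow> nat \<Rightarrow> real \<Rightarrow> real \<Rightarrow> bool" where
  "is_epoch_complexity R m \<epsilon> I \<longleftrightarrow> R powr (real m * I) = \<epsilon>"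

end

theory Submission
  imports Defs
begin

text \<open>Write \<open>S = I - T\<close>, let \<open>y\<close> be the delayed iterate at time \<open>k\<close>, \<open>X = \<parallel>x\<^sup>k - x\<^sup>*\<parallel>\<close>, \<open>s = \<parallel>S y\<parallel>\<close> and
\<open>D\<^sub>l = \<parallel>x\<^sup>k\<^sup>+\<^sup>1\<^sup>-\<^sup>l - x\<^sup>k\<^sup>-\<^sup>l\<parallel>\<close>. Since \<open>T\<close> is an \<open>r\<close>-contraction,
\<open>2 \<langle>y - x\<^sup>*, S y\<rangle> \<ge> (1 - r\<^sup>2) \<parallel>y - x\<^sup>*\<parallel>\<^sup>2 + s\<^sup>2\<close> (\<open>contraction_inner\<close>). A step along a uniformly
chosen block has the direction of \<open>- S y / m\<close> on average, so with \<open>y = x\<^sup>k\<close> and \<open>\<eta> = 1\<close> the squared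
error would shrink at least by the factor \<open>\<rho> = 1 - (1 - r\<^sup>2) / m\<close>. Two things disturb this: the inner product is
available at \<open>y\<close> and not at \<open>x\<^sup>k\<close>, and \<open>y\<close> must be compared with \<open>x\<^sup>k\<close>.

Both disturbances are controlled by \<open>\<parallel>y - x\<^sup>k\<parallel> \<le> \<Sum> D\<^sub>l\<close> over \<open>l \<le> j(k)\<close>
(\<open>norm_delayed_iterate_diff_le\<close>): they cost \<open>2 D\<^sub>l s\<close> and \<open>2 (1 - r\<^sup>2) D\<^sub>l X\<close> for each \<open>l \<le> j(k)\<close>.
Young's inequality splits them into \<open>D\<^sub>l\<^sup>2\<close>, \<open>s\<^sup>2\<close> and \<open>X\<^sup>2\<close> (\<open>mean_step_young_le\<close>). With weights
proportional to \<open>\<rho>\<^sup>-\<^sup>l\<^sup>/\<^sup>2 m\<^sup>-\<^sup>1\<^sup>/\<^sup>2\<close>, and an additional factor \<open>P\<^sub>l\<^sup>1\<^sup>/\<^sup>2\<close> for \<open>s\<^sup>2\<close>, the total weight on \<open>s\<^sup>2\<close> is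
\<open>M\<^sub>2 m\<^sup>-\<^sup>1\<^sup>/\<^sup>2\<close>, while the weight on \<open>X\<^sup>2\<close> is of order \<open>M\<^sub>1 m\<^sup>-\<^sup>1\<^sup>/\<^sup>2\<close> after averaging over the delay, which turns
\<open>l \<le> j(k)\<close> into the factor \<open>P\<^sub>l\<close> (\<open>nn_cond_exp_lyapunov_le\<close>). The history terms of the Lyapunov
function pay for the \<open>D\<^sub>l\<^sup>2\<close>: the coefficients solve \<open>c\<^sub>l\<^sub>+\<^sub>1 + g\<^sub>l = \<rho> c\<^sub>l\<close>, where \<open>g\<^sub>l\<close> is the averaged cost at
\<open>D\<^sub>l\<^sup>2\<close>, so that \<open>c\<^sub>1 = \<Sum> g\<^sub>l \<rho>\<^sup>-\<^sup>l\<close> is again a combination of \<open>M\<^sub>1\<close> and \<open>M\<^sub>2\<close>. The new increment puts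
\<open>c\<^sub>1 \<eta>\<^sup>2 s\<^sup>2 / m\<^sup>2\<close> back into the account of \<open>s\<^sup>2\<close>, and \<open>\<eta>\<^sub>1\<close> is precisely the step size at which this
account balances (\<open>nn_cond_exp_lyapunov_le_rate\<close>).

Without delays all \<open>P\<^sub>l\<close> with \<open>l \<ge> 1\<close> vanish, the account balances at \<open>\<eta> = 1\<close>, and the recursion would give
\<open>c = 0\<close>. To keep the coefficients positive in all cases, a fraction \<open>1 / m\<close> of the contraction is set
aside: \<open>\<parallel>y - x\<^sup>*\<parallel>\<^sup>2 \<ge> s\<^sup>2 / 4\<close> converts it into a surplus at \<open>s\<^sup>2\<close>, which pays for the additional constant
\<open>(1 - r\<^sup>2) / 4\<close> in \<open>c\<^sub>1\<close>. This changes the rate only by \<open>O(m\<^sup>-\<^sup>2)\<close>.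

The conditional expectation is computed by two applications of Fubini's theorem
(\<open>nn_integral_indep_freeze\<close>): the block index is independent of the past including the current delays,
and the delay vector is independent of the iterates. Finally \<open>1 - \<eta>\<^sub>1\<close> and the weights are
\<open>O(m\<^sup>q\<^sup>-\<^sup>1\<^sup>/\<^sup>2)\<close>, which gives the rate, and \<open>- m ln R = (1 - r\<^sup>2) + O(m\<^sup>q\<^sup>-\<^sup>1\<^sup>/\<^sup>2)\<close> gives the complexity.\<close>

section \<open>Orthogonal blocks\<close>

lemma norm_diff_sq: "(norm (u - z))\<^sup>2 = (norm u)\<^sup>2 - 2 * (u \<bullet> z) + (norm z)\<^sup>2" for u z :: "'a::real_inner"
  by (simp add: power2_norm_eq_inner inner_diff_left inner_diff_right inner_commute)

lemma orthogonal_blocks_inner_sum: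
  assumes ob: "orthogonal_blocks H m B"
    and y: "\<And>l. l \<in> {1..m} \<Longrightarrow> y l \<in> B l" and z: "\<And>l. l \<in> {1..m} \<Longrightarrow> z l \<in> B l"
  shows "(\<Sum>l=1..m. y l) \<bullet> (\<Sum>l=1..m. z l) = (\<Sum>l=1..m. y l \<bullet> z l)"
proof -
  have "(\<Sum>l=1..m. y l) \<bullet> (\<Sum>l=1..m. z l) = (\<Sum>l=1..m. \<Sum>l'=1..m. y l \<bullet> z l')"
    by (simp add: inner_sum_left inner_sum_right) (rule sum.swap)
  also have "\<dots> = (\<Sum>l=1..m. \<Sum>l'=1..m. if l' = l then y l \<bullet> z l else 0)"
  proof (intro sum.cong refl)
    fix l l' assume "l \<in> {1..m}" "l' \<in> {1..m}"
    then show "y l \<bullet> z l' = (if l' = l then y l \<bullet> z l else 0)"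
      using ob y z unfolding orthogonal_blocks_def orthogonal_def by auto
  qed
  finally show ?thesis by simp
qed

text \<open>Orthogonality makes the decomposition into blocks unique, so the definite description in
\<^const>\<open>block\<close> picks the given summands.\<close>

lemma block_sum:
  assumes ob: "orthogonal_blocks H m B"
    and y: "\<And>l. l \<in> {1..m} \<Longrightarrow> y l \<in> B l" and l: "l \<in> {1..m}"
  shows "block m B l (\<Sum>l=1..m. y l) = y l"
proof -
  let ?y = "restrict y {1..m}"
  have "(THE z. z \<in> (\<Pi>\<^sub>E l\<in>{1..m}. B l) \<and> (\<Sum>l=1..m. y l) = (\<Sum>l=1..m. z l)) = ?y"
  proof (rule the_equality)
    show "?y \<in> (\<Pi>\<^sub>E l\<in>{1..m}. B l) \<and> (\<Sum>l=1..m. y l) = (\<Sum>l=1..m. ?y l)"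
      using y by auto
  next
    fix z assume z: "z \<in> (\<Pi>\<^sub>E l\<in>{1..m}. B l) \<and> (\<Sum>l=1..m. y l) = (\<Sum>l=1..m. z l)"
    have mem: "y l - z l \<in> B l" if "l \<in> {1..m}" for l
      using that z y[OF that] ob
      by (auto simp: orthogonal_blocks_def PiE_def Pi_def intro!: subspace_diff)
    have "(\<Sum>l=1..m. y l - z l) \<bullet> (\<Sum>l=1..m. y l - z l) = 0"
      using z by (simp add: sum_subtractf)
    then have "(\<Sum>l=1..m. (y l - z l) \<bullet> (y l - z l)) = 0"
      using orthogonal_blocks_inner_sum[OF ob mem mem] by auto
    then have "\<forall>l\<in>{1..m}. (y l - z l) \<bullet> (y l - z l) = 0"
      by (subst (asm) sum_nonneg_eq_0_iff) auto
    then have "\<And>l. l \<in> {1..m} \<Longrightarrow> z l = y l" by simp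
    then show "z = ?y"
      using z by (auto simp: PiE_def extensional_def fun_eq_iff restrict_def)
  qed
  then show ?thesis unfolding block_def using l by simp
qed

context
  fixes H :: "'a::real_inner set" and m :: nat and B :: "nat \<Rightarrow> 'a set"
  assumes ob: "orthogonal_blocks H m B"
begin

lemma block_decomposition:
  assumes "x \<in> H"
  shows block_in: "l \<in> {1..m} \<Longrightarrow> block m B l x \<in> B l"
    and sum_block: "(\<Sum>l=1..m. block m B l x) = x"
proof -
  obtain y where y: "x = (\<Sum>l=1..m. y l)" "\<forall>l\<in>{1..m}. y l \<in> B l"
    using assms ob unfolding orthogonal_blocks_def by auto
  then have b: "\<And>l. l \<in> {1..m} \<Longrightarrow> block m B l x = y l"
    using block_sum[OF ob, of y] by auto
  show "l \<in> {1..m} \<Longrightarrow> block m B l x \<in> B l" using b y by auto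
  show "(\<Sum>l=1..m. block m B l x) = x" using b y by simp
qed

lemma sum_blocks_in:
  assumes "\<And>l. l \<in> {1..m} \<Longrightarrow> y l \<in> B l"
  shows "(\<Sum>l=1..m. y l) \<in> H"
  using assms ob unfolding orthogonal_blocks_def by blast

lemma block_diff:
  assumes "x \<in> H" "y \<in> H"
  shows diff_in: "x - y \<in> H"
    and "l \<in> {1..m} \<Longrightarrow> block m B l (x - y) = block m B l x - block m B l y"
proof -
  let ?d = "\<lambda>l. block m B l x - block m B l y"
  have d: "\<And>l. l \<in> {1..m} \<Longrightarrow> ?d l \<in> B l"
    using block_in[OF assms(1)] block_in[OF assms(2)] ob
    by (auto simp: orthogonal_blocks_def intro!: subspace_diff)
  have s: "(\<Sum>l=1..m. ?d l) = x - y"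
    using assms by (simp add: sum_subtractf sum_block del: One_nat_def)
  show "x - y \<in> H" using sum_blocks_in[of ?d, OF d] s by simp
  show "l \<in> {1..m} \<Longrightarrow> block m B l (x - y) = ?d l"
    using block_sum[OF ob, of ?d l, OF d] s by simp
qed

text \<open>Keeping only some of the blocks of a vector is an orthogonal projection. Delays that differ from
block to block mask each past increment in this way.\<close>

lemma norm_masked_blocks_le:
  assumes "x \<in> H" and "U \<subseteq> {1..m}"
  shows "norm (\<Sum>l\<in>U. block m B l x) \<le> norm x"
proof -
  let ?u = "\<lambda>l. if l \<in> U then block m B l x else 0"
  have u: "\<And>l. l \<in> {1..m} \<Longrightarrow> ?u l \<in> B l"
    using block_in[OF assms(1)] ob by (auto simp: orthogonal_blocks_def subspace_0)
  have eq: "(\<Sum>l=1..m. ?u l) = (\<Sum>l\<in>U. block m B l x)"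
    using assms(2) by (simp add: sum.If_cases Int_absorb1)
  have "(norm (\<Sum>l\<in>U. block m B l x))\<^sup>2 = (\<Sum>l=1..m. ?u l \<bullet> ?u l)"
    unfolding eq[symmetric] power2_norm_eq_inner
    by (rule orthogonal_blocks_inner_sum[OF ob]) (use u in auto)
  also have "\<dots> \<le> (\<Sum>l=1..m. block m B l x \<bullet> block m B l x)"
    by (intro sum_mono) auto
  also have "\<dots> = (norm (\<Sum>l=1..m. block m B l x))\<^sup>2"
    unfolding power2_norm_eq_inner
    by (rule orthogonal_blocks_inner_sum[OF ob, symmetric]) (use block_in[OF assms(1)] in auto)
  also have "\<dots> = (norm x)\<^sup>2" using sum_block[OF assms(1)] by simp
  finally show ?thesis by (rule power2_le_imp_le) simp
qed

lemma sum_norm_block_sq: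
  assumes "x \<in> H"
  shows "(\<Sum>l=1..m. (norm (block m B l x))\<^sup>2) = (norm x)\<^sup>2"
proof -
  have "(norm (\<Sum>l=1..m. block m B l x))\<^sup>2 = (\<Sum>l=1..m. block m B l x \<bullet> block m B l x)"
    unfolding power2_norm_eq_inner
    by (rule orthogonal_blocks_inner_sum[OF ob]) (use block_in[OF assms(1)] in auto)
  then show ?thesis using sum_block[OF assms] by (simp add: power2_norm_eq_inner)
qed

text \<open>Divided by \<open>m\<close>, this is the expected squared distance after a step along one uniformly chosen block
of \<open>z\<close>: the blocks of \<open>z\<close> add up to \<open>z\<close>, and their squared norms to that of \<open>z\<close>.\<close>

lemma sum_norm_block_step_sq:
  assumes "z \<in> H"
  shows "(\<Sum>l=1..m. (norm (u - t *\<^sub>R block m B l z))\<^sup>2)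
    = real m * (norm u)\<^sup>2 - 2 * t * (u \<bullet> z) + t\<^sup>2 * (norm z)\<^sup>2"
proof -
  have "(norm (u - t *\<^sub>R block m B l z))\<^sup>2
      = (norm u)\<^sup>2 - 2 * t * (u \<bullet> block m B l z) + t\<^sup>2 * (norm (block m B l z))\<^sup>2" for l
    by (simp add: norm_diff_sq power_mult_distrib)
  then have "(\<Sum>l=1..m. (norm (u - t *\<^sub>R block m B l z))\<^sup>2)
      = real m * (norm u)\<^sup>2 - 2 * t * (u \<bullet> (\<Sum>l=1..m. block m B l z))
        + t\<^sup>2 * (\<Sum>l=1..m. (norm (block m B l z))\<^sup>2)"
    by (simp add: sum.distrib sum_subtractf sum_distrib_left inner_sum_right)
  then show ?thesis using sum_block[OF assms] sum_norm_block_sq[OF assms] by simp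
qed

lemma continuous_on_block:
  assumes l: "l \<in> {1..m}"
  shows "continuous_on H (block m B l)"
proof -
  have "1-lipschitz_on H (block m B l)"
  proof (rule lipschitz_onI)
    fix x y assume xy: "x \<in> H" "y \<in> H"
    have "norm (\<Sum>l\<in>{l}. block m B l (x - y)) \<le> norm (x - y)"
      using diff_in[OF xy] l by (intro norm_masked_blocks_le) auto
    then show "dist (block m B l x) (block m B l y) \<le> 1 * dist x y"
      using block_diff(2)[OF xy l] by (simp add: dist_norm)
  qed simp
  then show ?thesis by (rule lipschitz_on_continuous_on)
qed

lemma delayed_iterate_in:
  assumes "\<And>n. p n \<in> H"
  shows "delayed_iterate m B p d k \<in> H"
  unfolding delayed_iterate_def by (rule sum_blocks_in) (rule block_in[OF assms])

text \<open>Telescoping each block over its own delay and regrouping by time, \<open>p k\<close> minus the delayed iterate is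
the sum over \<open>l\<close> of the increments \<open>p (k + 1 - l) - p (k - l)\<close> restricted to the blocks with delay at
least \<open>l\<close>. The restriction does not increase norms, and it is empty once \<open>l\<close> exceeds the largest
delay.\<close>

lemma norm_delayed_iterate_diff_le:
  assumes p: "\<And>n. p n \<in> H" and m: "1 \<le> m"
  shows "norm (delayed_iterate m B p d k - p k)
    \<le> (\<Sum>l=1..k. if l \<le> Max (d ` {1..m}) then norm (p (k + 1 - l) - p (k - l)) else 0)"
proof -
  let ?b = "block m B"
  let ?e = "\<lambda>l. p (k + 1 - l) - p (k - l)"
  have tele: "p k - p (k - n) = (\<Sum>l=1..k. if l \<le> n then ?e l else 0)" for n
  proof (induction n)
    case 0
    have "(\<Sum>l=1..k. if l \<le> 0 then ?e l else 0) = 0" by (intro sum.neutral) auto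
    then show ?case by simp
  next
    case (Suc n)
    have "(\<Sum>l=1..k. if l \<le> Suc n then ?e l else 0)
      = (\<Sum>l=1..k. (if l \<le> n then ?e l else 0) + (if l = Suc n then ?e (Suc n) else 0))"
      by (intro sum.cong) auto
    also have "\<dots> = p k - p (k - n) + (if Suc n \<le> k then ?e (Suc n) else 0)"
      by (simp add: sum.distrib Suc.IH)
    finally show ?case by (auto simp: not_le)
  qed
  have eH: "?e l \<in> H" for l using p by (intro diff_in)
  have bsum: "?b i (\<Sum>l\<in>L. f l) = (\<Sum>l\<in>L. ?b i (f l))"
    if "finite L" "i \<in> {1..m}" "\<And>l. f l \<in> H" for L f i
  proof -
    \<comment> \<open>Additivity of the block map, again from uniqueness of the decomposition.\<close>
    have s: "(\<Sum>l\<in>L. \<Sum>i=1..m. ?b i (f l)) = (\<Sum>l\<in>L. f l)"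
      by (intro sum.cong refl sum_block that)
    have "?b i (\<Sum>i=1..m. \<Sum>l\<in>L. ?b i (f l)) = (\<Sum>l\<in>L. ?b i (f l))"
      using ob that by (intro block_sum[OF ob])
        (auto simp: orthogonal_blocks_def intro!: subspace_sum block_in)
    then show ?thesis by (subst (asm) sum.swap) (simp only: s)
  qed
  have zero: "0 \<in> H" using diff_in[OF p[of 0] p[of 0]] by simp
  have b0: "?b i 0 = 0" if "i \<in> {1..m}" for i
    using block_diff(2)[OF p[of 0] p[of 0] that] by simp
  have comp: "?b i (p k) - ?b i (p (k - n)) = (\<Sum>l=1..k. if l \<le> n then ?b i (?e l) else 0)"
    if i: "i \<in> {1..m}" for i n
  proof -
    have "?b i (p k) - ?b i (p (k - n)) = ?b i (p k - p (k - n))"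
      using block_diff(2)[OF p p i] by simp
    also have "\<dots> = (\<Sum>l=1..k. ?b i (if l \<le> n then ?e l else 0))"
      unfolding tele using eH zero i by (intro bsum) auto
    also have "\<dots> = (\<Sum>l=1..k. if l \<le> n then ?b i (?e l) else 0)"
      using b0[OF i] by (intro sum.cong) auto
    finally show ?thesis .
  qed
  have "p k - delayed_iterate m B p d k = (\<Sum>i=1..m. ?b i (p k) - ?b i (p (k - d i)))"
    unfolding delayed_iterate_def by (simp add: sum_subtractf sum_block[OF p] del: One_nat_def)
  also have "\<dots> = (\<Sum>i=1..m. \<Sum>l=1..k. if l \<le> d i then ?b i (?e l) else 0)"
    by (intro sum.cong refl comp)
  also have "\<dots> = (\<Sum>l=1..k. \<Sum>i=1..m. if l \<le> d i then ?b i (?e l) else 0)"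
    by (rule sum.swap)
  also have "\<dots> = (\<Sum>l=1..k. \<Sum>i\<in>{i\<in>{1..m}. l \<le> d i}. ?b i (?e l))"
    by (rule sum.cong[OF refl], rule sum.inter_filter[symmetric]) simp
  finally have "norm (p k - delayed_iterate m B p d k)
      \<le> (\<Sum>l=1..k. norm (\<Sum>i\<in>{i\<in>{1..m}. l \<le> d i}. ?b i (?e l)))"
    by (simp add: sum_norm_le)
  also have "\<dots> \<le> (\<Sum>l=1..k. if l \<le> Max (d ` {1..m}) then norm (?e l) else 0)"
  proof (rule sum_mono)
    fix l
    show "norm (\<Sum>i\<in>{i\<in>{1..m}. l \<le> d i}. ?b i (?e l))
        \<le> (if l \<le> Max (d ` {1..m}) then norm (?e l) else 0)"
    proof (cases "l \<le> Max (d ` {1..m})")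
      case True
      then show ?thesis by (simp only: if_True) (rule norm_masked_blocks_le[OF eH], auto)
    next
      case False
      have "d i \<le> Max (d ` {1..m})" if "i \<in> {1..m}" for i
        using that by (intro Max_ge) auto
      with False have "{i\<in>{1..m}. l \<le> d i} = {}"
        using order_trans by blast
      then show ?thesis using False by (simp only: sum.empty norm_zero if_False order_refl)
    qed
  qed
  finally show ?thesis by (simp add: norm_minus_commute)
qed

end

section \<open>Freezing an independent variable\<close>

text \<open>Independence makes the joint law of \<open>\<omega>\<close>, seen through \<open>F\<close>, and \<open>Y \<omega>\<close> a product measure, so Fubini's
theorem allows a second, independent sample point in \<open>Y\<close>. Using the identity as the \<open>F\<close>-measurable
variable avoids naming the variables that generate \<open>F\<close>.\<close>

lemma (in prob_space) nn_integral_indep_freeze: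
  assumes sub: "subalgebra M F" and Y[measurable]: "Y \<in> measurable M N"
    and ind: "indep_set (sets (vimage_algebra (space M) Y N)) (sets F)"
    and f[measurable]: "f \<in> borel_measurable (F \<Otimes>\<^sub>M N)"
  shows "(\<integral>\<^sup>+\<omega>. f (\<omega>, Y \<omega>) \<partial>M) = (\<integral>\<^sup>+\<omega>. (\<integral>\<^sup>+\<omega>'. f (\<omega>, Y \<omega>') \<partial>M) \<partial>M)"
proof -
  have X[measurable]: "(\<lambda>\<omega>. \<omega>) \<in> measurable M F"
    by (rule measurable_from_subalg[OF sub measurable_ident_sets[OF refl]])
  interpret X: prob_space "distr M F (\<lambda>\<omega>. \<omega>)" by (rule prob_space_distr) measurable
  interpret Y: prob_space "distr M N Y" by (rule prob_space_distr) measurable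
  have D: "distr M F (\<lambda>\<omega>. \<omega>) \<Otimes>\<^sub>M distr M N Y = distr M (F \<Otimes>\<^sub>M N) (\<lambda>\<omega>. (\<omega>, Y \<omega>))"
  proof (rule pair_measure_eqI)
    fix A B assume "A \<in> sets (distr M F (\<lambda>\<omega>. \<omega>))" "B \<in> sets (distr M N Y)"
    then have [measurable]: "A \<in> sets F" "B \<in> sets N" by auto
    then have AM: "A \<in> sets M" and A: "A \<inter> space M = A"
      using sub sets.sets_into_space[of A F] by (auto simp: subalgebra_def)
    have "Y -` B \<inter> space M \<in> sets (vimage_algebra (space M) Y N)"
      by (rule in_vimage_algebra) measurable
    then have "prob (Y -` B \<inter> space M \<inter> A) = prob (Y -` B \<inter> space M) * prob A"
      using ind by (intro indep_setD) auto
    moreover have "(\<lambda>\<omega>. (\<omega>, Y \<omega>)) -` (A \<times> B) \<inter> space M = Y -` B \<inter> space M \<inter> A"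
      using A by auto
    ultimately show "emeasure (distr M F (\<lambda>\<omega>. \<omega>)) A * emeasure (distr M N Y) B
        = emeasure (distr M (F \<Otimes>\<^sub>M N) (\<lambda>\<omega>. (\<omega>, Y \<omega>))) (A \<times> B)"
      using AM A by (simp add: emeasure_distr emeasure_eq_measure ennreal_mult[symmetric] mult.commute)
  qed (auto intro: X.sigma_finite_measure_axioms Y.sigma_finite_measure_axioms cong: sets_pair_measure_cong)
  have "(\<integral>\<^sup>+\<omega>. f (\<omega>, Y \<omega>) \<partial>M) = (\<integral>\<^sup>+z. f z \<partial>(distr M F (\<lambda>\<omega>. \<omega>) \<Otimes>\<^sub>M distr M N Y))"
    unfolding D by (subst nn_integral_distr) auto
  also have "\<dots> = (\<integral>\<^sup>+a. (\<integral>\<^sup>+b. f (a, b) \<partial>distr M N Y) \<partial>distr M F (\<lambda>\<omega>. \<omega>))"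
    by (rule Y.nn_integral_fst[symmetric]) simp
  also have "\<dots> = (\<integral>\<^sup>+\<omega>. (\<integral>\<^sup>+b. f (\<omega>, b) \<partial>distr M N Y) \<partial>M)"
    by (subst nn_integral_distr) auto
  also have "\<dots> = (\<integral>\<^sup>+\<omega>. (\<integral>\<^sup>+\<omega>'. f (\<omega>, Y \<omega>') \<partial>M) \<partial>M)"
    using measurable_space[OF X]
    by (intro nn_integral_cong nn_integral_distr) (auto intro!: measurable_Pair2[OF f])
  finally show ?thesis .
qed

text \<open>For the operator and the block projections, which are continuous on \<open>H\<close> but unconstrained outside
of it.\<close>

lemma borel_measurable_compose_continuous_on:
  fixes f :: "'b::topological_space \<Rightarrow> 'c::topological_space"
  assumes "continuous_on A f" and "g \<in> borel_measurable N" and "\<And>\<omega>. \<omega> \<in> space N \<Longrightarrow> g \<omega> \<in> A"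
  shows "(\<lambda>\<omega>. f (g \<omega>)) \<in> borel_measurable N"
proof -
  have "g \<in> measurable N (restrict_space borel A)"
    by (rule measurable_restrict_space2) (use assms in auto)
  from measurable_compose[OF this borel_measurable_continuous_on_restrict[OF assms(1)]]
  show ?thesis .
qed

section \<open>Measurability of the iterates\<close>

context arock
begin

lemma iterate_step:
  assumes "\<omega> \<in> space M"
  shows "x (Suc k) \<omega> = x k \<omega> - \<eta> k *\<^sub>R block m B (i k \<omega>)
    (delayed_iterate m B (\<lambda>n. x n \<omega>) (\<lambda>a. j k a \<omega>) k - T (delayed_iterate m B (\<lambda>n. x n \<omega>) (\<lambda>a. j k a \<omega>) k))"
    (is "_ = _ - _ *\<^sub>R block m B _ ?z")
proof -
  have ik: "i k \<omega> \<in> {1..m}" using measurable_space[OF i_measurable assms] by simp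
  have "x (Suc k) \<omega> = (\<Sum>l=1..m. block m B l (x (Suc k) \<omega>))"
    using sum_block[OF blocks x_in[OF assms]] by simp
  also have "\<dots> = (\<Sum>l=1..m. block m B l (x k \<omega>) - (if l = i k \<omega> then \<eta> k *\<^sub>R block m B l ?z else 0))"
  proof (rule sum.cong[OF refl])
    fix l assume "l \<in> {1..m}"
    from x_step[OF assms this, of k]
    show "block m B l (x (Suc k) \<omega>)
        = block m B l (x k \<omega>) - (if l = i k \<omega> then \<eta> k *\<^sub>R block m B l ?z else 0)"
      by (simp add: Let_def)
  qed
  also have "\<dots> = x k \<omega> - \<eta> k *\<^sub>R block m B (i k \<omega>) ?z"
    using ik sum_block[OF blocks x_in[OF assms]] by (simp add: sum_subtractf del: One_nat_def)
  finally show ?thesis .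
qed

text \<open>The joint measurability in the path and the delay vector is needed for Fubini's theorem. Each block
depends on a single delay, which takes countably many values.\<close>

lemma measurable_delayed_residual:
  assumes meas: "\<And>n. n \<le> k \<Longrightarrow> x n \<in> borel_measurable N" and sp: "space N = space M"
    and l: "l \<in> {1..m}"
  shows "(\<lambda>(\<omega>, d). block m B l (delayed_iterate m B (\<lambda>n. x n \<omega>) d k - T (delayed_iterate m B (\<lambda>n. x n \<omega>) d k)))
    \<in> borel_measurable (N \<Otimes>\<^sub>M delay_space m)"
proof -
  let ?N = "N \<Otimes>\<^sub>M delay_space m"
  let ?y = "\<lambda>z. delayed_iterate m B (\<lambda>n. x n (fst z)) (snd z) k"
  have fst_in: "fst z \<in> space M" if "z \<in> space ?N" for z
    using that unfolding space_pair_measure sp by auto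
  have y: "?y \<in> borel_measurable ?N"
    unfolding delayed_iterate_def
  proof (rule borel_measurable_sum)
    fix a assume a: "a \<in> {1..m}"
    have d: "(\<lambda>z. snd z a) \<in> measurable ?N (count_space UNIV)"
      by (rule measurable_compose[OF measurable_snd measurable_component_singleton[OF a]])
    have "(\<lambda>z. block m B a (x (k - n) (fst z))) \<in> borel_measurable ?N" for n
    proof (rule borel_measurable_compose_continuous_on[OF continuous_on_block[OF blocks a]])
      show "(\<lambda>z. x (k - n) (fst z)) \<in> borel_measurable ?N"
        by (rule measurable_compose[OF measurable_fst meas]) (rule diff_le_self)
    qed (use fst_in x_in in auto)
    from measurable_compose_countable[OF this d]
    show "(\<lambda>z. block m B a (x (k - snd z a) (fst z))) \<in> borel_measurable ?N" .
  qed
  have yH: "?y z \<in> H" if "z \<in> space ?N" for z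
    by (rule delayed_iterate_in[OF blocks]) (rule x_in[OF fst_in[OF that]])
  have Ty: "(\<lambda>z. T (?y z)) \<in> borel_measurable ?N"
    by (rule borel_measurable_compose_continuous_on[OF lipschitz_on_continuous_on[OF T_lipschitz] y yH])
  have "(\<lambda>z. block m B l (?y z - T (?y z))) \<in> borel_measurable ?N"
  proof (rule borel_measurable_compose_continuous_on[OF continuous_on_block[OF blocks l]])
    show "(\<lambda>z. ?y z - T (?y z)) \<in> borel_measurable ?N"
      using y Ty by (rule borel_measurable_diff)
    show "?y z - T (?y z) \<in> H" if "z \<in> space ?N" for z
      by (rule diff_in[OF blocks yH[OF that] funcset_mem[OF T_maps yH[OF that]]])
  qed
  then show ?thesis by (simp only: case_prod_beta')
qed

lemma delayed_iterate_delay_vec: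
  "delayed_iterate m B p (delay_vec m j k \<omega>) k = delayed_iterate m B p (\<lambda>a. j k a \<omega>) k"
  unfolding delayed_iterate_def delay_vec_def by (intro sum.cong) auto

lemma iterate_measurable [measurable]: "x k \<in> borel_measurable M"
proof (induction k rule: less_induct)
  case (less k)
  show ?case
  proof (cases k)
    case 0 then show ?thesis using x0_measurable by simp
  next
    case (Suc k')
    note [measurable] = j_measurable
    let ?z = "\<lambda>\<omega>. delayed_iterate m B (\<lambda>n. x n \<omega>) (delay_vec m j k' \<omega>) k'
        - T (delayed_iterate m B (\<lambda>n. x n \<omega>) (delay_vec m j k' \<omega>) k')"
    have [measurable]: "x k' \<in> borel_measurable M" using less Suc by simp
    have "(\<lambda>\<omega>. block m B l (?z \<omega>)) \<in> borel_measurable M" if "l \<in> {1..m}" for l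
    proof -
      have "(\<lambda>\<omega>. (\<omega>, delay_vec m j k' \<omega>)) \<in> measurable M (M \<Otimes>\<^sub>M delay_space m)" by measurable
      from measurable_compose[OF this measurable_delayed_residual[OF _ refl that]]
      show ?thesis using less Suc by simp
    qed
    from measurable_compose_countable'[OF this i_measurable[of k']]
    have [measurable]: "(\<lambda>\<omega>. block m B (i k' \<omega>) (?z \<omega>)) \<in> borel_measurable M" by simp
    have "(\<lambda>\<omega>. x k' \<omega> - \<eta> k' *\<^sub>R block m B (i k' \<omega>) (?z \<omega>)) \<in> borel_measurable M" by measurable
    then show ?thesis
      unfolding Suc by (rule measurable_cong[THEN iffD1, rotated])
        (simp add: iterate_step delayed_iterate_delay_vec)
  qed
qed

lemma space_G [simp]: "space (G_filtration M x k) = space M"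
  and sets_G: "sets (G_filtration M x k)
    = sigma_sets (space M) (\<Union>n\<le>k. {x n -` A \<inter> space M | A. A \<in> sets borel})"
  unfolding G_filtration_def by (auto simp: space_measure_of sets_measure_of intro!: space_measure_of sets_measure_of)

lemma space_F [simp]: "space (F_filtration M m x j k) = space M"
  and sets_F: "sets (F_filtration M m x j k) = sigma_sets (space M)
     ((\<Union>n\<le>k. {x n -` A \<inter> space M | A. A \<in> sets borel}) \<union>
      (\<Union>n\<le>k. {delay_vec m j n -` A \<inter> space M | A. A \<in> sets (delay_space m)}))"
  unfolding F_filtration_def by (auto intro!: space_measure_of sets_measure_of)

lemma iterate_measurable_G: "n \<le> k \<Longrightarrow> x n \<in> borel_measurable (G_filtration M x k)"
  by (rule measurableI) (auto simp: sets_G intro!: sigma_sets.Basic)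

lemma delay_measurable_F: "delay_vec m j k \<in> measurable (F_filtration M m x j k) (delay_space m)"
  by (rule measurableI) (use measurable_space[OF j_measurable] in \<open>auto simp: sets_F intro!: sigma_sets.Basic UnI2\<close>)

lemma subalgebra_F: "subalgebra M (F_filtration M m x j k)"
  unfolding subalgebra_def sets_F
  using iterate_measurable j_measurable
  by (auto intro!: sets.sigma_sets_subset)

lemma subalgebra_G: "subalgebra M (G_filtration M x k)"
  unfolding subalgebra_def sets_G using iterate_measurable by (auto intro!: sets.sigma_sets_subset)

lemma G_subset_F: "sets (G_filtration M x k) \<subseteq> sets (F_filtration M m x j k)"
  unfolding sets_G sets_F by (rule sigma_sets_mono') auto

end

section \<open>Conditional expectation of one step\<close>

context arock_iid
begin

text \<open>Given the iterates up to time \<open>k\<close>, the next step is a function of the past, of the delays and of the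
block index. The block index can be averaged out uniformly, because it is independent of the past and
the current delays together; what remains involves the delays only, which are independent of the past.
The outcome is an integral over a fresh copy \<open>\<omega>'\<close> of the sample point that enters through the delays
alone.\<close>

lemma nn_cond_exp_step:
  assumes \<Phi>: "\<And>l. l \<in> {1..m} \<Longrightarrow> (\<lambda>z. \<Phi> z l) \<in> borel_measurable (G_filtration M x k \<Otimes>\<^sub>M delay_space m)"
    and f: "f \<in> borel_measurable M" "\<And>\<omega>. \<omega> \<in> space M \<Longrightarrow> f \<omega> = \<Phi> (\<omega>, delay_vec m j k \<omega>) (i k \<omega>)"
  shows "AE \<omega> in M. nn_cond_exp M (G_filtration M x k) f \<omega>
    = (\<integral>\<^sup>+\<omega>'. (\<Sum>l=1..m. \<Phi> (\<omega>, delay_vec m j k \<omega>') l) / ennreal (real m) \<partial>M)"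
    (is "AE \<omega> in M. _ = ?h \<omega>")
proof -
  let ?G = "G_filtration M x k" and ?F = "F_filtration M m x j k"
  let ?J = "delay_vec m j k" and ?D = "delay_space m"
  note [measurable] = j_measurable
  define \<Psi> where "\<Psi> z = (\<Sum>l=1..m. \<Phi> z l) / ennreal (real m)" for z
  have \<Psi>[measurable]: "\<Psi> \<in> borel_measurable (?G \<Otimes>\<^sub>M ?D)"
    unfolding \<Psi>_def[abs_def] using \<Phi> by (intro borel_measurable_divide_ennreal borel_measurable_sum) auto
  have h[measurable]: "?h \<in> borel_measurable ?G"
  proof -
    have "(\<lambda>z. \<Psi> (fst z, ?J (snd z))) \<in> borel_measurable (?G \<Otimes>\<^sub>M M)" by measurable
    then have "(\<lambda>(\<omega>, \<omega>'). \<Psi> (\<omega>, ?J \<omega>')) \<in> borel_measurable (?G \<Otimes>\<^sub>M M)"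
      by (simp add: case_prod_beta')
    then show ?thesis unfolding \<Psi>_def[symmetric] by (rule borel_measurable_nn_integral)
  qed
  have set_integral: "(\<integral>\<^sup>+\<omega>\<in>A. f \<omega> \<partial>M) = (\<integral>\<^sup>+\<omega>\<in>A. ?h \<omega> \<partial>M)" if A: "A \<in> sets ?G" for A
  proof -
    have A_F[measurable]: "A \<in> sets ?F" and A_G[measurable]: "A \<in> sets ?G"
      using A G_subset_F by auto
    let ?f = "\<lambda>(\<omega>, l). \<Phi> (\<omega>, ?J \<omega>) l * indicator A \<omega>"
    have \<Phi>F: "(\<lambda>\<omega>. \<Phi> (\<omega>, ?J \<omega>) l) \<in> borel_measurable ?F" if "l \<in> {1..m}" for l
    proof (rule measurable_compose[OF _ \<Phi>[OF that]])
      have "(\<lambda>\<omega>. \<omega>) \<in> measurable ?F ?G"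
        by (rule measurable_from_subalg[OF _ measurable_ident_sets[OF refl]])
          (simp add: subalgebra_def G_subset_F)
      then show "(\<lambda>\<omega>. (\<omega>, ?J \<omega>)) \<in> measurable ?F (?G \<Otimes>\<^sub>M ?D)"
        using delay_measurable_F by (rule measurable_Pair)
    qed
    have "(\<lambda>z. (\<lambda>l z. \<Phi> (fst z, ?J (fst z)) l * indicator A (fst z)) (snd z) z)
        \<in> borel_measurable (?F \<Otimes>\<^sub>M count_space {1..m})"
    proof (rule measurable_compose_countable'[where g = snd and I = "{1..m}"
          and f = "\<lambda>l z. \<Phi> (fst z, ?J (fst z)) l * indicator A (fst z)"])
      fix l assume "l \<in> {1..m}"
      note [measurable] = \<Phi>F[OF this]
      show "(\<lambda>z. \<Phi> (fst z, ?J (fst z)) l * indicator A (fst z))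
          \<in> borel_measurable (?F \<Otimes>\<^sub>M count_space {1..m})"
        by measurable
    qed auto
    then have f_meas: "?f \<in> borel_measurable (?F \<Otimes>\<^sub>M count_space {1..m})"
      by (simp add: case_prod_beta')
    have avg: "(\<integral>\<^sup>+\<omega>'. ?f (\<omega>, i k \<omega>') \<partial>M) = \<Psi> (\<omega>, ?J \<omega>) * indicator A \<omega>" for \<omega>
    proof -
      have "(\<integral>\<^sup>+\<omega>'. ?f (\<omega>, i k \<omega>') \<partial>M) = (\<integral>\<^sup>+l. ?f (\<omega>, l) \<partial>distr M (count_space {1..m}) (i k))"
        by (rule nn_integral_distr[symmetric, OF i_measurable]) simp
      also have "\<dots> = (\<Sum>l=1..m. ?f (\<omega>, l)) / ennreal (real m)"
        unfolding i_uniform uniform_count_measure_def using m_pos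
        by (subst nn_integral_point_measure_finite)
          (auto simp: sum_distrib_left[symmetric] divide_ennreal_def inverse_ennreal inverse_eq_divide mult.commute)
      finally show ?thesis
        by (cases "\<omega> \<in> A") (simp_all add: \<Psi>_def)
    qed
    have "(\<integral>\<^sup>+\<omega>\<in>A. f \<omega> \<partial>M) = (\<integral>\<^sup>+\<omega>. ?f (\<omega>, i k \<omega>) \<partial>M)"
      using f(2) by (intro nn_integral_cong) simp
    also have "\<dots> = (\<integral>\<^sup>+\<omega>. (\<integral>\<^sup>+\<omega>'. ?f (\<omega>, i k \<omega>') \<partial>M) \<partial>M)"
      by (rule nn_integral_indep_freeze[OF subalgebra_F i_measurable i_indep_F f_meas])
    also have "\<dots> = (\<integral>\<^sup>+\<omega>. (\<lambda>z. \<Psi> z * indicator A (fst z)) (\<omega>, ?J \<omega>) \<partial>M)"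
      by (simp only: avg[unfolded case_prod_conv] case_prod_conv fst_conv)
    also have "\<dots> = (\<integral>\<^sup>+\<omega>. (\<integral>\<^sup>+\<omega>'. \<Psi> (\<omega>, ?J \<omega>') * indicator A \<omega> \<partial>M) \<partial>M)"
    proof -
      have "(\<lambda>z. \<Psi> z * indicator A (fst z)) \<in> borel_measurable (?G \<Otimes>\<^sub>M ?D)" by measurable
      from nn_integral_indep_freeze[OF subalgebra_G j_measurable j_indep_G this]
      show ?thesis by (simp only: fst_conv)
    qed
    also have "\<dots> = (\<integral>\<^sup>+\<omega>\<in>A. ?h \<omega> \<partial>M)"
    proof (intro nn_integral_cong)
      fix \<omega> assume \<omega>: "\<omega> \<in> space M"
      then have "(\<lambda>\<omega>'. \<Psi> (\<omega>, ?J \<omega>')) \<in> borel_measurable M"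
        by (intro measurable_compose[OF j_measurable] measurable_Pair2[OF \<Psi>]) simp
      then show "(\<integral>\<^sup>+\<omega>'. \<Psi> (\<omega>, ?J \<omega>') * indicator A \<omega> \<partial>M) = ?h \<omega> * indicator A \<omega>"
        unfolding \<Psi>_def[symmetric] by (rule nn_integral_multc)
    qed
    finally show ?thesis .
  qed
  interpret sigma_finite_subalgebra M ?G
    by (rule finite_measure_subalgebra_is_sigma_finite)
      (use subalgebra_G in \<open>unfold_locales, auto\<close>)
  have "AE \<omega> in M. ?h \<omega> = nn_cond_exp M ?G f \<omega>"
    by (rule nn_cond_exp_charact[OF _ f(1) h]) (rule set_integral)
  then show ?thesis by eventually_elim (rule sym)
qed

end

section \<open>Descent for given delays\<close>

lemma young_weighted: "0 < w \<Longrightarrow> 2 * a * b \<le> a\<^sup>2 / w + w * b\<^sup>2" for a b w :: real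
proof -
  assume w: "0 < w"
  have "0 \<le> (a - w * b)\<^sup>2 / w" using w by simp
  also have "\<dots> = a\<^sup>2 / w + w * b\<^sup>2 - 2 * a * b"
    using w by (simp add: power2_diff field_simps power2_eq_square)
  finally show ?thesis by simp
qed

context arock
begin

text \<open>The first inequality is \<open>\<parallel>T y - x\<^sup>*\<parallel> \<le> r \<parallel>y - x\<^sup>*\<parallel>\<close>, squared and expanded with
\<open>T y - x\<^sup>* = (y - x\<^sup>*) - (y - T y)\<close>.\<close>

lemma contraction_inner:
  assumes y: "y \<in> H"
  shows "(1 - r\<^sup>2) * (norm (y - xs))\<^sup>2 + (norm (y - T y))\<^sup>2 \<le> 2 * ((y - xs) \<bullet> (y - T y))"
    and "(norm (y - T y))\<^sup>2 \<le> 4 * (norm (y - xs))\<^sup>2"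
proof -
  have "norm (T y - T xs) \<le> r * norm (y - xs)"
    using lipschitz_onD[OF T_lipschitz y xs_in] by (simp add: dist_norm)
  then have L: "norm (T y - xs) \<le> r * norm (y - xs)" by (simp add: xs_fixed)
  have "(norm (T y - xs))\<^sup>2 \<le> r\<^sup>2 * (norm (y - xs))\<^sup>2"
    using power_mono[OF L norm_ge_zero, of 2] by (simp add: power_mult_distrib)
  moreover have "(norm (T y - xs))\<^sup>2
      = (norm (y - xs))\<^sup>2 - 2 * ((y - xs) \<bullet> (y - T y)) + (norm (y - T y))\<^sup>2"
    using norm_diff_sq[of "y - xs" "y - T y"] by simp
  ultimately show "(1 - r\<^sup>2) * (norm (y - xs))\<^sup>2 + (norm (y - T y))\<^sup>2 \<le> 2 * ((y - xs) \<bullet> (y - T y))"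
    by (simp add: algebra_simps)
  have "norm (y - T y) \<le> norm (y - xs) + norm (T y - xs)"
    using norm_triangle_ineq4[of "y - xs" "T y - xs"] by simp
  also have "\<dots> \<le> norm (y - xs) + 1 * norm (y - xs)"
    using L mult_right_mono[OF less_imp_le[OF r_less_1] norm_ge_zero[of "y - xs"]] by linarith
  finally have "norm (y - T y) \<le> 2 * norm (y - xs)" by simp
  then have "(norm (y - T y))\<^sup>2 \<le> (2 * norm (y - xs))\<^sup>2" by (rule power_mono) simp
  then show "(norm (y - T y))\<^sup>2 \<le> 4 * (norm (y - xs))\<^sup>2" by (simp add: power_mult_distrib)
qed

text \<open>The left-hand side is the average, over the blocks, of the part of the new Lyapunov function that
depends on the step; \<open>C\<close> stands for the first coefficient. A fraction \<open>1 / m\<close> of the contraction term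
\<open>(1 - r\<^sup>2) \<parallel>y - x\<^sup>*\<parallel>\<^sup>2\<close> is converted into the surplus \<open>(1 - r\<^sup>2) s\<^sup>2 / (4 m)\<close>, and the rest into a
contraction of \<open>X\<^sup>2\<close> with an error linear in \<open>\<Delta>\<close>.\<close>

lemma mean_step_le:
  fixes p and d :: "nat \<Rightarrow> nat" and k :: nat and e \<Delta> C :: real
  assumes p: "\<And>n. p n \<in> H" and e: "0 \<le> e"
  defines "y \<equiv> delayed_iterate m B p d k"
  defines "s \<equiv> norm (y - T y)" and "X \<equiv> norm (p k - xs)"
  assumes \<Delta>: "norm (y - p k) \<le> \<Delta>"
  shows "(\<Sum>l=1..m. (norm (p k - e *\<^sub>R block m B l (y - T y) - xs))\<^sup>2
            + C / m * (norm (e *\<^sub>R block m B l (y - T y)))\<^sup>2) / m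
    \<le> X\<^sup>2 * (1 - e / m * ((1 - r\<^sup>2) * (1 - 1 / m)))
      + e / m * (2 * \<Delta> * s + (1 - r\<^sup>2) * (2 * \<Delta> * X)
          + s\<^sup>2 * (e - 1 + C * e / m - (1 - r\<^sup>2) / (4 * m)))"
proof -
  have m: "0 < real m" using m_pos by simp
  have r2: "0 \<le> 1 - r\<^sup>2" using r_pos r_less_1 by (simp add: power_le_one)
  have \<Delta>0: "0 \<le> \<Delta>" using \<Delta> norm_ge_zero order_trans by blast
  have yH: "y \<in> H" unfolding y_def by (rule delayed_iterate_in[OF blocks p])
  have zH: "y - T y \<in> H" using yH T_maps by (intro diff_in[OF blocks]) auto
  define u where "u = p k - xs"
  have "(\<Sum>l=1..m. (norm (p k - e *\<^sub>R block m B l (y - T y) - xs))\<^sup>2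
            + C / m * (norm (e *\<^sub>R block m B l (y - T y)))\<^sup>2)
      = (\<Sum>l=1..m. (norm (u - e *\<^sub>R block m B l (y - T y)))\<^sup>2)
        + C / m * e\<^sup>2 * (\<Sum>l=1..m. (norm (block m B l (y - T y)))\<^sup>2)"
    by (simp add: sum.distrib sum_distrib_left power_mult_distrib u_def algebra_simps)
  also have "\<dots> = m * X\<^sup>2 - 2 * e * (u \<bullet> (y - T y)) + e\<^sup>2 * s\<^sup>2 + C / m * e\<^sup>2 * s\<^sup>2"
    unfolding sum_norm_block_step_sq[OF blocks zH] sum_norm_block_sq[OF blocks zH]
    by (simp add: X_def u_def s_def)
  finally have "(\<Sum>l=1..m. (norm (p k - e *\<^sub>R block m B l (y - T y) - xs))\<^sup>2
            + C / m * (norm (e *\<^sub>R block m B l (y - T y)))\<^sup>2) / m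
      = X\<^sup>2 + e / m * (- 2 * (u \<bullet> (y - T y)) + e * s\<^sup>2 + C * e / m * s\<^sup>2)"
    using m by (simp add: field_simps power2_eq_square)
  also have "\<dots> \<le> X\<^sup>2 + e / m * (2 * \<Delta> * s + (1 - r\<^sup>2) * (2 * \<Delta> * X)
          - (1 - r\<^sup>2) * (1 - 1 / m) * X\<^sup>2 + s\<^sup>2 * (e - 1 + C * e / m - (1 - r\<^sup>2) / (4 * m)))"
  proof (intro add_left_mono mult_left_mono)
    have "u \<bullet> (y - T y) = (y - xs) \<bullet> (y - T y) - (y - p k) \<bullet> (y - T y)"
      by (simp add: u_def inner_diff_left)
    moreover have "(y - p k) \<bullet> (y - T y) \<le> \<Delta> * s"
      unfolding s_def by (rule order_trans[OF norm_cauchy_schwarz mult_right_mono[OF \<Delta>]]) simp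
    ultimately have inn: "- 2 * (u \<bullet> (y - T y)) \<le> 2 * \<Delta> * s - (1 - r\<^sup>2) * (norm (y - xs))\<^sup>2 - s\<^sup>2"
      using contraction_inner(1)[OF yH] by (simp add: s_def)
    define Y where "Y = (norm (y - xs))\<^sup>2"
    have "Y = X\<^sup>2 + 2 * ((y - p k) \<bullet> u) + (norm (y - p k))\<^sup>2"
      using norm_diff_sq[of u "p k - y"] unfolding Y_def X_def u_def
      by (simp add: inner_diff_left inner_diff_right inner_commute norm_minus_commute algebra_simps)
    moreover have "- ((y - p k) \<bullet> u) \<le> \<Delta> * X"
    proof -
      have "- ((y - p k) \<bullet> u) \<le> norm (y - p k) * norm u"
        using Cauchy_Schwarz_ineq2[of "y - p k" u] by linarith
      also have "\<dots> \<le> \<Delta> * X" unfolding X_def u_def by (intro mult_right_mono \<Delta>) simp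
      finally show ?thesis .
    qed
    \<comment> \<open>Only the lower bound matters, so the square of the displacement is dropped.\<close>
    ultimately have "X\<^sup>2 - 2 * \<Delta> * X \<le> Y"
      using zero_le_power2[of "norm (y - p k)"] by linarith
    then have 1: "(1 - 1 / m) * (X\<^sup>2 - 2 * \<Delta> * X) \<le> (1 - 1 / m) * Y"
      using m_pos by (intro mult_left_mono) auto
    have 2: "1 / m * (s\<^sup>2 / 4) \<le> 1 / m * Y"
      using contraction_inner(2)[OF yH] m by (intro mult_left_mono) (auto simp: Y_def s_def)
    have "0 \<le> 1 / m * (2 * \<Delta> * X)" using \<Delta>0 by (simp add: X_def)
    with 1 2 have "(1 - 1 / m) * X\<^sup>2 - 2 * \<Delta> * X + 1 / m * (s\<^sup>2 / 4) \<le> Y"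
      unfolding left_diff_distrib right_diff_distrib mult_1 by linarith
    note mult_left_mono[OF this r2]
    moreover have "a * (b * X\<^sup>2 - t + 1 / m * (s\<^sup>2 / 4)) = a * b * X\<^sup>2 - a * t + s\<^sup>2 * (a / (4 * m))" for a b t
      by (simp add: algebra_simps)
    ultimately have "(1 - r\<^sup>2) * (1 - 1 / m) * X\<^sup>2 - (1 - r\<^sup>2) * (2 * \<Delta> * X) + s\<^sup>2 * ((1 - r\<^sup>2) / (4 * m)) \<le> (1 - r\<^sup>2) * Y"
      by metis
    with inn show "- 2 * (u \<bullet> (y - T y)) + e * s\<^sup>2 + C * e / m * s\<^sup>2
      \<le> 2 * \<Delta> * s + (1 - r\<^sup>2) * (2 * \<Delta> * X)
          - (1 - r\<^sup>2) * (1 - 1 / m) * X\<^sup>2 + s\<^sup>2 * (e - 1 + C * e / m - (1 - r\<^sup>2) / (4 * m))"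
      unfolding Y_def[symmetric] by (simp add: algebra_simps)
  qed (use e in simp)
  finally show ?thesis by (simp add: algebra_simps)
qed

text \<open>Young's inequality with weights \<open>w l\<close> for \<open>D l * s\<close> and \<open>v l\<close> for \<open>D l * X\<close>. The budget condition
bounds the total coefficient of \<open>s\<^sup>2\<close> by zero. There all \<open>w l\<close> are charged, also those with \<open>l > J\<close>, and
hence the bound holds for each delay vector separately and no average of \<open>s\<^sup>2\<close>, which depends on the
delays, has to be estimated. The weights \<open>w l\<close> may vanish beyond the delays that occur.\<close>

lemma mean_step_young_le:
  fixes p and d :: "nat \<Rightarrow> nat" and k :: nat and e C :: real and v w :: "nat \<Rightarrow> real"
  assumes p: "\<And>n. p n \<in> H" and e: "0 \<le> e"
  defines "y \<equiv> delayed_iterate m B p d k"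
  defines "D \<equiv> \<lambda>l. norm (p (k + 1 - l) - p (k - l))" and "X \<equiv> norm (p k - xs)"
  defines "J \<equiv> Max (d ` {1..m})"
  assumes w: "\<And>l. 1 \<le> l \<Longrightarrow> 0 \<le> w l" "\<And>l. 1 \<le> l \<Longrightarrow> l \<le> J \<Longrightarrow> 0 < w l"
    and v: "\<And>l. 1 \<le> l \<Longrightarrow> 0 < v l"
    and budget: "(\<Sum>l=1..k. w l) + e - 1 + C * e / m - (1 - r\<^sup>2) / (4 * m) \<le> 0"
  shows "(\<Sum>l=1..m. (norm (p k - e *\<^sub>R block m B l (y - T y) - xs))\<^sup>2
            + C / m * (norm (e *\<^sub>R block m B l (y - T y)))\<^sup>2) / m
    \<le> X\<^sup>2 * (1 - e / m * ((1 - r\<^sup>2) * (1 - 1 / m)))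
      + e / m * (\<Sum>l=1..k. (if l \<le> J then 1 else 0) *
           ((D l)\<^sup>2 / w l + (1 - r\<^sup>2) * ((D l)\<^sup>2 / v l + v l * X\<^sup>2)))"
proof -
  define s where "s = norm (y - T y)"
  define \<Delta> where "\<Delta> = (\<Sum>l=1..k. if l \<le> J then D l else 0)"
  have r2: "0 \<le> 1 - r\<^sup>2" using r_pos r_less_1 by (simp add: power_le_one)
  have "norm (y - p k) \<le> \<Delta>"
    unfolding \<Delta>_def y_def J_def D_def by (rule norm_delayed_iterate_diff_le[OF blocks p m_pos])
  note step = mean_step_le[OF p e this[unfolded y_def], of C, folded y_def, folded s_def X_def]
  define Q where "Q = (\<Sum>l=1..k. (if l \<le> J then 1 else 0) *
           ((D l)\<^sup>2 / w l + (1 - r\<^sup>2) * ((D l)\<^sup>2 / v l + v l * X\<^sup>2)))"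
  have "2 * \<Delta> * s + (1 - r\<^sup>2) * (2 * \<Delta> * X)
      = (\<Sum>l=1..k. (if l \<le> J then 2 * D l * s + (1 - r\<^sup>2) * (2 * D l * X) else 0))"
    unfolding \<Delta>_def sum_distrib_left sum_distrib_right sum.distrib[symmetric] by (intro sum.cong) auto
  also have "\<dots> \<le> (\<Sum>l=1..k. (if l \<le> J then 1 else 0) *
           ((D l)\<^sup>2 / w l + (1 - r\<^sup>2) * ((D l)\<^sup>2 / v l + v l * X\<^sup>2)) + w l * s\<^sup>2)"
  proof (rule sum_mono)
    fix l assume l: "l \<in> {1..k}"
    show "(if l \<le> J then 2 * D l * s + (1 - r\<^sup>2) * (2 * D l * X) else 0)
      \<le> (if l \<le> J then 1 else 0) *
           ((D l)\<^sup>2 / w l + (1 - r\<^sup>2) * ((D l)\<^sup>2 / v l + v l * X\<^sup>2)) + w l * s\<^sup>2"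
      using young_weighted[OF w(2), of l "D l" s] mult_left_mono[OF young_weighted[OF v, of l "D l" X] r2]
        w(1)[of l] l by auto
  qed
  also have "\<dots> = Q + s\<^sup>2 * (\<Sum>l=1..k. w l)"
    by (simp add: Q_def sum.distrib sum_distrib_left mult.commute)
  finally have "2 * \<Delta> * s + (1 - r\<^sup>2) * (2 * \<Delta> * X)
      + s\<^sup>2 * (e - 1 + C * e / m - (1 - r\<^sup>2) / (4 * m)) \<le> Q"
    using mult_nonneg_nonpos[OF zero_le_power2[of s] budget] by (simp add: algebra_simps)
  from mult_left_mono[OF this, of "e / m"] e
  show ?thesis unfolding Q_def[symmetric] by (intro order_trans[OF step] add_left_mono) auto
qed

end

section \<open>Averaging over the delays\<close>

text \<open>For \<open>l > k\<close> both iterates in the increment are \<open>p 0\<close>.\<close>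

lemma lyapunov_eq_sum:
  "lyapunov m c xs p k = (norm (p k - xs))\<^sup>2
     + 1 / real m * (\<Sum>l=1..k. c l * (norm (p (k + 1 - l) - p (k - l)))\<^sup>2)"
proof -
  have "(\<Sum>n. c (Suc n) * (norm (p (k + 1 - Suc n) - p (k - Suc n)))\<^sup>2)
      = (\<Sum>n<k. c (Suc n) * (norm (p (k + 1 - Suc n) - p (k - Suc n)))\<^sup>2)"
    by (rule suminf_finite) auto
  also have "\<dots> = (\<Sum>l=1..k. c l * (norm (p (k + 1 - l) - p (k - l)))\<^sup>2)"
    by (rule sum.reindex_bij_witness[of _ "\<lambda>l. l - 1" Suc]) auto
  finally show ?thesis unfolding lyapunov_def by simp
qed

lemma lyapunov_Suc:
  "lyapunov m c xs p (Suc k) = (norm (p (Suc k) - xs))\<^sup>2 + c 1 / m * (norm (p (Suc k) - p k))\<^sup>2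
     + 1 / real m * (\<Sum>l=1..k. c (Suc l) * (norm (p (k + 1 - l) - p (k - l)))\<^sup>2)"
proof -
  have "(\<Sum>l=1..Suc k. c l * (norm (p (Suc k + 1 - l) - p (Suc k - l)))\<^sup>2)
      = c 1 * (norm (p (Suc k) - p k))\<^sup>2
        + (\<Sum>l=Suc 1..Suc k. c l * (norm (p (Suc k + 1 - l) - p (Suc k - l)))\<^sup>2)"
    by (subst sum.atLeast_Suc_atMost) auto
  also have "(\<Sum>l=Suc 1..Suc k. c l * (norm (p (Suc k + 1 - l) - p (Suc k - l)))\<^sup>2)
      = (\<Sum>l=1..k. c (Suc l) * (norm (p (k + 1 - l) - p (k - l)))\<^sup>2)"
    by (subst sum.shift_bounds_cl_Suc_ivl) simp
  finally show ?thesis unfolding lyapunov_eq_sum by (simp add: algebra_simps)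
qed

context arock_iid
begin

text \<open>Sufficient conditions on the coefficients \<open>c\<close> and the weights \<open>v\<close>, \<open>w\<close> for the contraction of the
Lyapunov function by the factor \<open>R\<close>: integrating the bound \<open>mean_step_young_le\<close> over the delays replaces the
event \<open>l \<le> j(k)\<close> by its probability \<open>P l\<close>; \<open>drift\<close> and \<open>rate\<close> then compare the coefficients of
\<open>(D l)\<^sup>2\<close> and of \<open>X\<^sup>2\<close>. If \<open>P l = 0\<close>, then \<open>w l = 0\<close> is permitted, and the term \<open>P l / w l\<close> is \<open>0\<close> by the
convention for division by zero.\<close>

lemma nn_cond_exp_lyapunov_le:
  fixes e :: real and P :: "nat \<Rightarrow> real" and c v w :: "nat \<Rightarrow> real" and R :: real
  assumes step_size: "\<eta> k = e" "0 \<le> e"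
    and P: "\<And>l. P l = prob {\<omega> \<in> space M. l \<le> current_delay m j k \<omega>}"
    and c: "\<And>l. 1 \<le> l \<Longrightarrow> 0 \<le> c l"
    and w: "\<And>l. 1 \<le> l \<Longrightarrow> 0 \<le> w l" "\<And>l. 1 \<le> l \<Longrightarrow> 0 < P l \<Longrightarrow> 0 < w l"
    and v: "\<And>l. 1 \<le> l \<Longrightarrow> 0 < v l"
    and budget: "(\<Sum>l=1..k. w l) + e - 1 + c 1 * e / m - (1 - r\<^sup>2) / (4 * m) \<le> 0"
    and drift: "\<And>l. 1 \<le> l \<Longrightarrow> c (Suc l) + e * (P l / w l + (1 - r\<^sup>2) * P l / v l) \<le> R * c l"
    and rate: "1 - e / m * ((1 - r\<^sup>2) * (1 - 1 / m)) + e / m * (1 - r\<^sup>2) * (\<Sum>l=1..k. P l * v l) \<le> R"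
  shows "AE \<omega> in M. nn_cond_exp M (G_filtration M x k)
      (\<lambda>\<omega>. ennreal (lyapunov m c xs (\<lambda>n. x n \<omega>) (Suc k))) \<omega>
    \<le> ennreal (R * lyapunov m c xs (\<lambda>n. x n \<omega>) k)"
proof -
  let ?G = "G_filtration M x k" and ?D = "delay_space m" and ?J = "delay_vec m j k"
  let ?z = "\<lambda>\<omega> d. delayed_iterate m B (\<lambda>n. x n \<omega>) d k - T (delayed_iterate m B (\<lambda>n. x n \<omega>) d k)"
  have m: "0 < real m" using m_pos by simp
  have r2: "0 \<le> 1 - r\<^sup>2" using r_pos r_less_1 by (simp add: power_le_one)
  define S where "S \<omega> = 1 / real m * (\<Sum>l=1..k. c (Suc l) * (norm (x (k + 1 - l) \<omega> - x (k - l) \<omega>))\<^sup>2)" for \<omega>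
  have S0: "0 \<le> S \<omega>" for \<omega> unfolding S_def using c by (intro mult_nonneg_nonneg sum_nonneg) auto
  define \<Phi> where "\<Phi> z l = (norm (x k (fst z) - e *\<^sub>R block m B l (?z (fst z) (snd z)) - xs))\<^sup>2
      + c 1 / m * (norm (e *\<^sub>R block m B l (?z (fst z) (snd z))))\<^sup>2" for z l
  have \<Phi>0: "0 \<le> \<Phi> z l" for z l unfolding \<Phi>_def using c[of 1] by simp
  have x_G: "x n \<in> borel_measurable ?G" if "n \<le> k" for n by (rule iterate_measurable_G[OF that])
  have \<Phi>_meas: "(\<lambda>z. ennreal (\<Phi> z l + S (fst z))) \<in> borel_measurable (?G \<Otimes>\<^sub>M ?D)" if l: "l \<in> {1..m}" for l
  proof -
    have b: "(\<lambda>z. block m B l (?z (fst z) (snd z))) \<in> borel_measurable (?G \<Otimes>\<^sub>M ?D)"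
      using measurable_delayed_residual[OF x_G space_G l] by (simp only: case_prod_beta')
    have xk: "(\<lambda>z. x n (fst z)) \<in> borel_measurable (?G \<Otimes>\<^sub>M ?D)" if "n \<le> k" for n
      by (rule measurable_compose[OF measurable_fst x_G[OF that]])
    show ?thesis unfolding \<Phi>_def S_def
      by (intro measurable_compose[OF _ measurable_ennreal] borel_measurable_add borel_measurable_power
          measurable_compose[OF _ borel_measurable_norm] borel_measurable_diff borel_measurable_times borel_measurable_const
          borel_measurable_scaleR borel_measurable_sum b xk) auto
  qed
  have f_meas: "(\<lambda>\<omega>. ennreal (lyapunov m c xs (\<lambda>n. x n \<omega>) (Suc k))) \<in> borel_measurable M"
    unfolding lyapunov_eq_sum by measurable
  have f_eq: "ennreal (lyapunov m c xs (\<lambda>n. x n \<omega>) (Suc k)) = ennreal (\<Phi> (\<omega>, ?J \<omega>) (i k \<omega>) + S (fst (\<omega>, ?J \<omega>)))"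
    if \<omega>: "\<omega> \<in> space M" for \<omega>
    unfolding lyapunov_Suc \<Phi>_def S_def
    by (simp add: iterate_step[OF \<omega>] step_size(1) delayed_iterate_delay_vec)
  have cond: "AE \<omega> in M. nn_cond_exp M ?G (\<lambda>\<omega>. ennreal (lyapunov m c xs (\<lambda>n. x n \<omega>) (Suc k))) \<omega>
      = (\<integral>\<^sup>+\<omega>'. (\<Sum>l=1..m. ennreal (\<Phi> (\<omega>, ?J \<omega>') l + S (fst (\<omega>, ?J \<omega>')))) / ennreal (real m) \<partial>M)"
    by (rule nn_cond_exp_step[where \<Phi> = "\<lambda>z l. ennreal (\<Phi> z l + S (fst z))"])
      (fact \<Phi>_meas f_meas f_eq)+
  have delay_meas: "{\<omega> \<in> space M. l \<le> current_delay m j k \<omega>} \<in> events" for l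
  proof -
    have "(\<lambda>\<omega>. ?J \<omega> a) \<in> measurable M (count_space UNIV)" if "a \<in> {1..m}" for a
      by (rule measurable_compose[OF j_measurable measurable_component_singleton[OF that]])
    then have [measurable]: "(\<lambda>\<omega>. j k a \<omega>) \<in> measurable M (count_space UNIV)" if "a \<in> {1..m}" for a
      using that by (simp add: delay_vec_def)
    have "l \<le> current_delay m j k \<omega> \<longleftrightarrow> (\<exists>a\<in>{1..m}. l \<le> j k a \<omega>)" for \<omega>
      unfolding current_delay_def using m_pos by (subst Max_ge_iff) auto
    then show ?thesis by simp
  qed
  \<comment> \<open>Delays of probability zero would need a positive weight in Young's inequality; they are excluded almost surely.\<close>
  have supp: "AE \<omega>' in M. \<forall>l. l \<le> current_delay m j k \<omega>' \<longrightarrow> 0 < P l"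
  proof (subst AE_all_countable, intro allI)
    fix l show "AE \<omega>' in M. l \<le> current_delay m j k \<omega>' \<longrightarrow> 0 < P l"
    proof (cases "0 < P l")
      case False
      then have "prob {\<omega> \<in> space M. l \<le> current_delay m j k \<omega>} = 0" using P[of l] by (simp add: zero_less_measure_iff)
      then have "{\<omega> \<in> space M. l \<le> current_delay m j k \<omega>} \<in> null_sets M"
        using delay_meas by (simp add: null_sets_def emeasure_eq_measure)
      then show ?thesis by (rule AE_I') auto
    qed simp
  qed
  have bound: "(\<integral>\<^sup>+\<omega>'. (\<Sum>l=1..m. ennreal (\<Phi> (\<omega>, ?J \<omega>') l + S (fst (\<omega>, ?J \<omega>')))) / ennreal (real m) \<partial>M)
      \<le> ennreal (R * lyapunov m c xs (\<lambda>n. x n \<omega>) k)" if \<omega>: "\<omega> \<in> space M" for \<omega>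
  proof -
    define D where "D l = norm (x (k + 1 - l) \<omega> - x (k - l) \<omega>)" for l
    define X where "X = norm (x k \<omega> - xs)"
    define q where "q l = (D l)\<^sup>2 / w l + (1 - r\<^sup>2) * ((D l)\<^sup>2 / v l + v l * X\<^sup>2)" for l
    define E where "E l = {\<omega> \<in> space M. l \<le> current_delay m j k \<omega>}" for l
    define b where "b \<omega>' = X\<^sup>2 * (1 - e / m * ((1 - r\<^sup>2) * (1 - 1 / m)))
        + e / m * (\<Sum>l=1..k. indicator (E l) \<omega>' * q l) + S \<omega>" for \<omega>'
    have E_meas[measurable]: "E l \<in> events" for l unfolding E_def by (rule delay_meas)
    have avg: "(\<Sum>l=1..m. ennreal (\<Phi> (\<omega>, d) l + S (fst (\<omega>, d)))) / ennreal (real m)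
        = ennreal ((\<Sum>l=1..m. \<Phi> (\<omega>, d) l) / m + S \<omega>)" for d
    proof -
      have "(\<Sum>l=1..m. ennreal (\<Phi> (\<omega>, d) l + S (fst (\<omega>, d)))) = ennreal (\<Sum>l=1..m. \<Phi> (\<omega>, d) l + S \<omega>)"
        using \<Phi>0 S0 by (subst sum_ennreal) auto
      moreover have "(\<Sum>l=1..m. \<Phi> (\<omega>, d) l + S \<omega>) / m = (\<Sum>l=1..m. \<Phi> (\<omega>, d) l) / m + S \<omega>"
        using m by (simp add: sum.distrib field_simps)
      ultimately show ?thesis
        using m \<Phi>0 S0 by (simp only: divide_ennreal sum_nonneg add_nonneg_nonneg)
    qed
    have ptw: "AE \<omega>' in M. (\<Sum>l=1..m. \<Phi> (\<omega>, ?J \<omega>') l) / m + S \<omega> \<le> b \<omega>'"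
      using supp AE_space
    proof eventually_elim
      fix \<omega>' assume supp': "\<forall>l. l \<le> current_delay m j k \<omega>' \<longrightarrow> 0 < P l" and \<omega>': "\<omega>' \<in> space M"
      have Max: "Max (?J \<omega>' ` {1..m}) = current_delay m j k \<omega>'"
        unfolding current_delay_def delay_vec_def by (intro arg_cong[where f = Max] image_cong) auto
      have ind: "indicator (E l) \<omega>' = (if l \<le> current_delay m j k \<omega>' then 1 else 0 :: real)" for l
        using \<omega>' by (simp add: E_def)
      have "(\<Sum>l=1..m. \<Phi> (\<omega>, ?J \<omega>') l) / m
        \<le> X\<^sup>2 * (1 - e / m * ((1 - r\<^sup>2) * (1 - 1 / m)))
        + e / m * (\<Sum>l=1..k. (if l \<le> Max (?J \<omega>' ` {1..m}) then 1 else 0) * q l)"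
        unfolding \<Phi>_def q_def D_def X_def fst_conv snd_conv
      proof (rule mean_step_young_le[OF x_in[OF \<omega>] step_size(2) w(1) _ v budget])
        fix l assume "1 \<le> l" "l \<le> Max (?J \<omega>' ` {1..m})"
        then show "0 < w l" using w(2) supp' unfolding Max by blast
      qed
      then show "(\<Sum>l=1..m. \<Phi> (\<omega>, ?J \<omega>') l) / m + S \<omega> \<le> b \<omega>'"
        unfolding b_def ind Max by (rule add_right_mono)
    qed
    have b_int: "integrable M b" unfolding b_def by (intro Bochner_Integration.integrable_add
          Bochner_Integration.integrable_sum integrable_mult_right integrable_mult_left integrable_const
          integrable_real_indicator) (auto simp: emeasure_eq_measure)
    have b0: "AE \<omega>' in M. 0 \<le> b \<omega>'"
      using ptw
    proof eventually_elim
      fix \<omega>' assume "(\<Sum>l=1..m. \<Phi> (\<omega>, ?J \<omega>') l) / m + S \<omega> \<le> b \<omega>'"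
      moreover have "0 \<le> (\<Sum>l=1..m. \<Phi> (\<omega>, ?J \<omega>') l) / m"
        using \<Phi>0 by (intro divide_nonneg_nonneg sum_nonneg) auto
      ultimately show "0 \<le> b \<omega>'" using S0[of \<omega>] by linarith
    qed
    have "(\<integral>\<^sup>+\<omega>'. (\<Sum>l=1..m. ennreal (\<Phi> (\<omega>, ?J \<omega>') l + S (fst (\<omega>, ?J \<omega>')))) / ennreal (real m) \<partial>M)
        \<le> (\<integral>\<^sup>+\<omega>'. ennreal (b \<omega>') \<partial>M)"
      unfolding avg by (intro nn_integral_mono_AE) (rule eventually_mono[OF ptw], rule ennreal_leI)
    also have "\<dots> = ennreal (\<integral>\<omega>'. b \<omega>' \<partial>M)"
      by (rule nn_integral_eq_integral[OF b_int b0])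
    also have "(\<integral>\<omega>'. b \<omega>' \<partial>M) = X\<^sup>2 * (1 - e / m * ((1 - r\<^sup>2) * (1 - 1 / m)))
        + e / m * (\<Sum>l=1..k. P l * q l) + S \<omega>"
    proof -
      have "(\<integral>\<omega>'. indicator (E l) \<omega>' * q l \<partial>M) = P l * q l" for l
        using P[of l] by (simp add: E_def[symmetric])
      moreover have int: "integrable M (\<lambda>\<omega>'. indicator (E l) \<omega>' * q l)" for l
        by (intro integrable_mult_left integrable_real_indicator) (auto simp: emeasure_eq_measure)
      ultimately have sum_eq: "(\<integral>\<omega>'. (\<Sum>l=1..k. indicator (E l) \<omega>' * q l) \<partial>M) = (\<Sum>l=1..k. P l * q l)"
        by (subst Bochner_Integration.integral_sum) (simp_all only:)
      have sum_int: "integrable M (\<lambda>\<omega>'. \<Sum>l=1..k. indicator (E l) \<omega>' * q l)"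
        by (rule Bochner_Integration.integrable_sum) (rule int)
      have affine: "(\<integral>\<omega>'. a + t * f \<omega>' + s \<partial>M) = a + t * (\<integral>\<omega>'. f \<omega>' \<partial>M) + s"
        if "integrable M f" for a t s :: real and f
        using that by (simp add: prob_space)
      show ?thesis unfolding b_def affine[OF sum_int] sum_eq ..
    qed
    also have "\<dots> = X\<^sup>2 * (1 - e / m * ((1 - r\<^sup>2) * (1 - 1 / m)) + e / m * (1 - r\<^sup>2) * (\<Sum>l=1..k. P l * v l))
        + 1 / m * (\<Sum>l=1..k. (c (Suc l) + e * (P l / w l + (1 - r\<^sup>2) * P l / v l)) * (D l)\<^sup>2)"
    proof -
      have "e / m * (\<Sum>l=1..k. P l * q l)
          = e / m * (1 - r\<^sup>2) * (\<Sum>l=1..k. P l * v l) * X\<^sup>2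
           + 1 / m * (\<Sum>l=1..k. e * (P l / w l + (1 - r\<^sup>2) * P l / v l) * (D l)\<^sup>2)"
        unfolding sum_distrib_left sum_distrib_right sum.distrib[symmetric]
      proof (rule sum.cong[OF refl])
        fix l
        have "P * (D2 / w' + a * (D2 / v' + v' * X2)) = a * (P * v') * X2 + (P / w' + a * P / v') * D2" 
          for P D2 w' v' a X2 :: real by (simp add: algebra_simps)
        then have "P l * q l = (1 - r\<^sup>2) * (P l * v l) * X\<^sup>2 + (P l / w l + (1 - r\<^sup>2) * P l / v l) * (D l)\<^sup>2"
          unfolding q_def .
        moreover have "e / m * (a * b * y + g * h) = e / m * a * b * y + 1 / m * (e * g * h)" for a b y g h
          by (simp add: algebra_simps)
        ultimately show "e / m * (P l * q l) = e / m * (1 - r\<^sup>2) * (P l * v l) * X\<^sup>2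
            + 1 / m * (e * (P l / w l + (1 - r\<^sup>2) * P l / v l) * (D l)\<^sup>2)"
          by (simp only:)
      qed
      moreover have "S \<omega> = 1 / m * (\<Sum>l=1..k. c (Suc l) * (D l)\<^sup>2)" unfolding S_def D_def ..
      moreover have "(\<Sum>l=1..k. (c (Suc l) + e * (P l / w l + (1 - r\<^sup>2) * P l / v l)) * (D l)\<^sup>2)
          = (\<Sum>l=1..k. c (Suc l) * (D l)\<^sup>2) + (\<Sum>l=1..k. e * (P l / w l + (1 - r\<^sup>2) * P l / v l) * (D l)\<^sup>2)"
        unfolding sum.distrib[symmetric] distrib_right ..
      moreover have "X\<^sup>2 * a + (t * X\<^sup>2 + 1 / m * g) + 1 / m * h = X\<^sup>2 * (a + t) + 1 / m * (h + g)" for a t g h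
        by (simp add: algebra_simps add_divide_distrib)
      ultimately show ?thesis by (simp only:)
    qed
    also have "\<dots> \<le> X\<^sup>2 * R + 1 / m * (\<Sum>l=1..k. R * c l * (D l)\<^sup>2)"
      using m by (intro add_mono mult_left_mono rate sum_mono mult_right_mono drift) auto
    also have "\<dots> = R * lyapunov m c xs (\<lambda>n. x n \<omega>) k"
      unfolding lyapunov_eq_sum X_def D_def by (simp add: sum_distrib_left algebra_simps)
    finally show ?thesis by (simp add: ennreal_leI)
  qed
  show ?thesis using cond AE_space by eventually_elim (use bound in simp)
qed

end

section \<open>Coefficients and rate\<close>

text \<open>The contraction factor \<open>\<rho>\<close> of one step without delays and with unit step size.\<close>

abbreviation (input) serial_rate :: "nat \<Rightarrow> real \<Rightarrow> real" where
  "serial_rate m r \<equiv> 1 - 1 / real m * (1 - r\<^sup>2)"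

text \<open>The cost \<open>g\<^sub>l\<close> at the \<open>l\<close>-th past increment, multiplied by \<open>\<rho>\<^sup>-\<^sup>l\<close>. The step size cancels because
the Young weights are proportional to it.\<close>

definition delay_weight :: "nat \<Rightarrow> real \<Rightarrow> (nat \<Rightarrow> real) \<Rightarrow> nat \<Rightarrow> real" where
  "delay_weight m r P l = sqrt m * (serial_rate m r) powr (- real l / 2) * (sqrt (P l) + sqrt (1 - r\<^sup>2) * P l)"

text \<open>The solution of \<open>c\<^sub>l\<^sub>+\<^sub>1 + g\<^sub>l = \<rho> c\<^sub>l\<close> that decays fastest, plus a multiple of the
homogeneous solution \<open>\<rho>\<^sup>l\<close>; the multiple keeps it positive when the delays are bounded.\<close>

definition lyapunov_coeff :: "nat \<Rightarrow> real \<Rightarrow> (nat \<Rightarrow> real) \<Rightarrow> nat \<Rightarrow> real" where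
  "lyapunov_coeff m r P l
     = (serial_rate m r) ^ (l - 1) * ((1 - r\<^sup>2) / 4 + (\<Sum>n. delay_weight m r P (n + l)))"

text \<open>The coefficient of \<open>\<parallel>x\<^sup>k - x\<^sup>*\<parallel>\<^sup>2\<close> after averaging. The factor \<open>1 - 1 / m\<close> is the part of the
contraction that is not set aside, and the term with \<open>M1\<close> is the price of evaluating it at the delayed
iterate.\<close>

definition arock_rate :: "nat \<Rightarrow> real \<Rightarrow> real \<Rightarrow> real \<Rightarrow> real" where
  "arock_rate m r e M1 = 1 - e / m * ((1 - r\<^sup>2) * (1 - 1 / m))
     + e / m * (1 - r\<^sup>2) * (e * sqrt (1 - r\<^sup>2) / sqrt m * M1)"

text \<open>The coefficients are built for the factor \<open>\<rho>\<close>; since the rate is never smaller, they also serve for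
the rate.\<close>

lemma arock_rate_ge:
  assumes r: "0 < r" "r < 1" and m: "1 \<le> m" and e: "0 \<le> e" "e \<le> 1" and M1: "0 \<le> M1"
  shows "serial_rate m r \<le> arock_rate m r e M1"
proof -
  have r2: "0 \<le> 1 - r\<^sup>2" using r by (simp add: power_le_one)
  have "e * ((1 - r\<^sup>2) * (1 - 1 / m)) \<le> 1 * ((1 - r\<^sup>2) * 1)"
    using e r2 m by (intro mult_mono) auto
  then have "e / m * ((1 - r\<^sup>2) * (1 - 1 / m)) \<le> 1 / m * (1 - r\<^sup>2)"
    using m by (simp add: divide_right_mono)
  moreover have "0 \<le> e / m * (1 - r\<^sup>2) * (e * sqrt (1 - r\<^sup>2) / sqrt m * M1)"
    using e r2 M1 by (intro mult_nonneg_nonneg divide_nonneg_nonneg) auto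
  ultimately show ?thesis unfolding arock_rate_def by linarith
qed

lemma serial_rate_pos:
  assumes "0 < r" "r < 1" "1 \<le> (m::nat)"
  shows "0 < serial_rate m r"
proof -
  have "1 / real m * (1 - r\<^sup>2) \<le> 1 * (1 - r\<^sup>2)"
    using assms by (intro mult_right_mono) (auto simp: power_le_one)
  then show ?thesis using assms by (smt (verit) zero_less_power)
qed

lemma delay_weight_nonneg:
  assumes "0 < r" "r < 1" "\<And>l. 0 \<le> P l"
  shows "0 \<le> delay_weight m r P l"
  unfolding delay_weight_def using assms(3)[of l] assms(1,2) by (simp add: power_le_one)

lemma delay_weight_sums:
  assumes "(\<lambda>l. P (Suc l) * (serial_rate m r) powr (- real (Suc l) / 2)) sums M1"
    and "(\<lambda>l. sqrt (P (Suc l)) * (serial_rate m r) powr (- real (Suc l) / 2)) sums M2"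
  shows "(\<lambda>l. delay_weight m r P (Suc l)) sums (sqrt m * (M2 + sqrt (1 - r\<^sup>2) * M1))"
  using sums_mult[OF sums_add[OF assms(2) sums_mult[OF assms(1), of "sqrt (1 - r\<^sup>2)"]], of "sqrt m"]
  unfolding delay_weight_def by (simp add: algebra_simps)

context
  fixes r M1 M2 :: real and m :: nat and P :: "nat \<Rightarrow> real"
  assumes r: "0 < r" "r < 1" and m: "1 \<le> m" and P: "\<And>l. 0 \<le> P l"
    and M1: "(\<lambda>l. P (Suc l) * (serial_rate m r) powr (- real (Suc l) / 2)) sums M1"
    and M2: "(\<lambda>l. sqrt (P (Suc l)) * (serial_rate m r) powr (- real (Suc l) / 2)) sums M2"
begin

lemma M1_nonneg: "0 \<le> M1" by (rule sums_le[OF _ sums_zero M1]) (use P in simp)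
lemma M2_nonneg: "0 \<le> M2" by (rule sums_le[OF _ sums_zero M2]) (use P in simp)

lemma summable_delay_weight: "1 \<le> l \<Longrightarrow> summable (\<lambda>n. delay_weight m r P (n + l))"
  using sums_summable[OF delay_weight_sums[OF M1 M2]]
    summable_iff_shift[of "delay_weight m r P" 1] summable_iff_shift[of "delay_weight m r P" l] by simp

lemma lyapunov_coeff_pos: "1 \<le> l \<Longrightarrow> 0 < lyapunov_coeff m r P l"
  unfolding lyapunov_coeff_def using r serial_rate_pos[OF r m] suminf_nonneg[OF summable_delay_weight delay_weight_nonneg[OF r P]]
  by (intro mult_pos_pos zero_less_power add_pos_nonneg) (auto simp: power_less_one_iff)

lemma lyapunov_coeff_1: "lyapunov_coeff m r P 1 = (1 - r\<^sup>2) / 4 + sqrt m * (M2 + sqrt (1 - r\<^sup>2) * M1)"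
  unfolding lyapunov_coeff_def using sums_unique[OF delay_weight_sums[OF M1 M2]] by simp

lemma lyapunov_coeff_Suc:
  assumes l: "1 \<le> l"
  shows "lyapunov_coeff m r P (Suc l) + (serial_rate m r) ^ l * delay_weight m r P l
    = (serial_rate m r) * lyapunov_coeff m r P l"
proof -
  define q where "q = serial_rate m r"
  have "q * q ^ (l - 1) = q ^ l" using l by (simp add: power_eq_if)
  moreover have "(\<Sum>n. delay_weight m r P (n + l)) = delay_weight m r P l + (\<Sum>n. delay_weight m r P (n + Suc l))"
    using suminf_split_head[OF summable_delay_weight[OF l]] by simp
  ultimately show ?thesis
    unfolding lyapunov_coeff_def q_def[symmetric] by (simp add: mult.assoc[symmetric] distrib_left)
qed

end

text \<open>With \<open>w\<close> proportional to \<open>P\<^sub>l\<^sup>1\<^sup>/\<^sup>2 \<rho>\<^sup>-\<^sup>l\<^sup>/\<^sup>2\<close> and \<open>v\<close> to \<open>\<rho>\<^sup>-\<^sup>l\<^sup>/\<^sup>2\<close> the weighted costs \<open>g\<^sub>l \<rho>\<^sup>-\<^sup>l\<close> are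
summable with sum \<open>sqrt m * (M2 + sqrt (1 - r\<^sup>2) * M1)\<close>. In the budget, \<open>M2\<close> enters once through the weights
\<open>w\<close> and once through \<open>c 1\<close>, and \<open>M1\<close> once through \<open>c 1\<close>; together this is \<open>e * \<theta> = 1 - e\<close>, which
determines the step size.\<close>

lemma (in arock_iid) nn_cond_exp_lyapunov_le_rate:
  fixes e M1 M2 :: real and P :: "nat \<Rightarrow> real"
  assumes step_size: "\<eta> k = e" "e = inverse (1 + (sqrt (1 - r\<^sup>2) * M1 + 2 * M2) / sqrt m)"
    and P: "\<And>l. P l = prob {\<omega> \<in> space M. l \<le> current_delay m j k \<omega>}"
    and M1: "(\<lambda>l. P (Suc l) * (serial_rate m r) powr (- real (Suc l) / 2)) sums M1"
    and M2: "(\<lambda>l. sqrt (P (Suc l)) * (serial_rate m r) powr (- real (Suc l) / 2)) sums M2"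
  defines "c \<equiv> lyapunov_coeff m r P"
  shows "AE \<omega> in M. nn_cond_exp M (G_filtration M x k)
      (\<lambda>\<omega>. ennreal (lyapunov m c xs (\<lambda>n. x n \<omega>) (Suc k))) \<omega>
    \<le> ennreal (arock_rate m r e M1 * lyapunov m c xs (\<lambda>n. x n \<omega>) k)"
proof -
  define q where "q = serial_rate m r"
  define A where "A = sqrt (1 - r\<^sup>2)"
  define s where "s = sqrt (real m)"
  define W where "W l = q powr (- real l / 2)" for l
  have P0: "0 \<le> P l" for l unfolding P by simp
  have r2: "0 < 1 - r\<^sup>2" using r_pos r_less_1 by (simp add: power_less_one_iff)
  have A: "0 < A" "A * A = 1 - r\<^sup>2" using r2 by (auto simp: A_def)
  have s: "0 < s" "real m = s * s" using m_pos by (auto simp: s_def)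
  have q: "0 < q" unfolding q_def by (rule serial_rate_pos[OF r_pos r_less_1 m_pos])
  have W: "0 < W l" for l using q by (simp add: W_def)
  have M10: "0 \<le> M1" and M20: "0 \<le> M2"
    using M1_nonneg[OF r_pos r_less_1 m_pos P0 M1 M2] M2_nonneg[OF r_pos r_less_1 m_pos P0 M1 M2] by auto
  define \<theta> where "\<theta> = (A * M1 + 2 * M2) / s"
  have \<theta>: "0 \<le> \<theta>" using M10 M20 A s by (simp add: \<theta>_def)
  have e_eq: "e = inverse (1 + \<theta>)" using step_size(2) by (simp add: \<theta>_def A_def s_def)
  have e: "0 < e" "e \<le> 1" using \<theta> by (auto simp: e_eq inverse_le_1_iff)
  have e\<theta>: "1 - e = e * \<theta>" using \<theta> by (simp add: e_eq field_simps)
  have cpos: "0 < c l" if "1 \<le> l" for l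
    unfolding c_def by (rule lyapunov_coeff_pos[OF r_pos r_less_1 m_pos P0 M1 M2 that])
  have sum_le: "(\<Sum>l=1..k. f l * W l) \<le> S"
    if "(\<lambda>l. f (Suc l) * q powr (- real (Suc l) / 2)) sums S" "\<And>l. 0 \<le> f l" for f S
  proof -
    have "(\<Sum>l=1..k. f l * W l) = (\<Sum>l<k. f (Suc l) * q powr (- real (Suc l) / 2))"
      unfolding W_def by (rule sum.reindex_bij_witness[of _ Suc "\<lambda>l. l - 1"]) auto
    also have "\<dots> \<le> S"
      using sum_le_suminf[OF sums_summable[OF that(1)], of "{..<k}"] sums_unique[OF that(1)] that(2) by simp
    finally show ?thesis .
  qed
  show ?thesis
  proof (rule nn_cond_exp_lyapunov_le[where w = "\<lambda>l. e / s * (sqrt (P l) * W l)"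
        and v = "\<lambda>l. e * A / s * W l", OF step_size(1) less_imp_le[OF e(1)] P])
    show "0 \<le> c l" if "1 \<le> l" for l using cpos[OF that] by simp
    show "0 \<le> e / s * (sqrt (P l) * W l)" for l using e s P0 W[of l] by simp
    show "0 < P l \<Longrightarrow> 0 < e / s * (sqrt (P l) * W l)" for l using e s W by simp
    show "0 < e * A / s * W l" for l using e s A W by simp
    have "(\<Sum>l=1..k. e / s * (sqrt (P l) * W l)) \<le> e / s * M2"
      unfolding sum_distrib_left[symmetric] using sum_le[of "\<lambda>l. sqrt (P l)", OF M2[folded q_def]] P0 e s
      by (intro mult_left_mono) auto
    moreover have "c 1 * e / m = e / s * (M2 + A * M1) + e * ((1 - r\<^sup>2) / (4 * m))"
      unfolding c_def lyapunov_coeff_1[OF r_pos r_less_1 m_pos P0 M1 M2] A_def[symmetric] s_def[symmetric]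
      using s by (simp add: field_simps)
    moreover have "e / s * M2 + e / s * (M2 + A * M1) = e * \<theta>"
      unfolding \<theta>_def using s by (simp add: field_simps)
    moreover have "e * ((1 - r\<^sup>2) / (4 * m)) \<le> 1 * ((1 - r\<^sup>2) / (4 * m))"
      using e r2 by (intro mult_right_mono) auto
    ultimately show "(\<Sum>l=1..k. e / s * (sqrt (P l) * W l)) + e - 1 + c 1 * e / m - (1 - r\<^sup>2) / (4 * m) \<le> 0"
      using e\<theta> by linarith
    show "c (Suc l) + e * (P l / (e / s * (sqrt (P l) * W l)) + (1 - r\<^sup>2) * P l / (e * A / s * W l))
        \<le> arock_rate m r e M1 * c l" if l: "1 \<le> l" for l
    proof -
      define U where "U = q powr (real l / 2)"
      have WU: "W l = 1 / U" and U: "0 < U" "q ^ l = U * U"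
        using q by (auto simp: W_def U_def powr_minus_divide powr_add[symmetric] powr_realpow)
      have 1: "e * (P l / (e / s * (sqrt (P l) * W l))) = s * U * sqrt (P l)"
        using e s U P0[of l] by (cases "P l = 0") (auto simp: WU field_simps real_sqrt_mult[symmetric])
      have 2: "e * ((1 - r\<^sup>2) * P l / (e * A / s * W l)) = s * U * (A * P l)"
        unfolding A(2)[symmetric] using e s U A(1) by (simp add: WU field_simps)
      have "e * (P l / (e / s * (sqrt (P l) * W l)) + (1 - r\<^sup>2) * P l / (e * A / s * W l))
          = s * U * (sqrt (P l) + A * P l)"
        unfolding distrib_left 1 2 ..
      also have "\<dots> = q ^ l * delay_weight m r P l"
        unfolding delay_weight_def q_def[symmetric] W_def[symmetric] s_def[symmetric] A_def[symmetric] WU U(2)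
        using U by simp
      finally have "c (Suc l) + e * (P l / (e / s * (sqrt (P l) * W l)) + (1 - r\<^sup>2) * P l / (e * A / s * W l))
          = q * c l"
        unfolding c_def q_def using lyapunov_coeff_Suc[OF r_pos r_less_1 m_pos P0 M1 M2 l] by simp
      also have "\<dots> \<le> arock_rate m r e M1 * c l"
        unfolding q_def using e M10 cpos[OF l]
        by (intro mult_right_mono arock_rate_ge r_pos r_less_1 m_pos) auto
      finally show ?thesis .
    qed
    have "(\<Sum>l=1..k. P l * (e * A / s * W l)) = e * A / s * (\<Sum>l=1..k. P l * W l)"
      by (simp add: sum_distrib_left mult_ac)
    also have "\<dots> \<le> e * A / s * M1"
      using sum_le[of P, OF M1[folded q_def]] P0 e s A by (intro mult_left_mono) auto
    finally show "1 - e / m * ((1 - r\<^sup>2) * (1 - 1 / m)) + e / m * (1 - r\<^sup>2) * (\<Sum>l=1..k. P l * (e * A / s * W l))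
        \<le> arock_rate m r e M1"
      unfolding arock_rate_def A_def[symmetric] s_def[symmetric] using e r2
      by (intro add_left_mono mult_left_mono) auto
  qed
qed

section \<open>Many blocks\<close>

text \<open>With \<open>t = - m ln (R m)\<close> the complexity is \<open>ln (1 / \<epsilon>) / t\<close>, so \<open>\<delta> = a / t - 1\<close>. For \<open>u = 1 - R m\<close> the
hypothesis says that \<open>m u\<close> differs from \<open>a\<close> by \<open>O(m\<^sup>q\<^sup>-\<^sup>1\<^sup>/\<^sup>2)\<close>, and passing from \<open>u\<close> to \<open>- ln (1 - u)\<close>
costs \<open>O(m u\<^sup>2) = O(1 / m)\<close>. The condition \<open>q < 1/2\<close> makes \<open>R m < 1\<close> for large \<open>m\<close>.\<close>

lemma epoch_complexity_asymptotics:
  fixes R :: "nat \<Rightarrow> real" and a q :: real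
  assumes a: "0 < a" and q: "0 \<le> q" "q < 1/2" and R_pos: "\<And>m. 1 \<le> m \<Longrightarrow> 0 < R m"
    and R: "(\<lambda>m. R m - (1 - 1 / real m * a)) \<in> O(\<lambda>m. real m powr (q - 3/2))"
  shows "\<exists>\<delta> :: nat \<Rightarrow> real. \<delta> \<in> O(\<lambda>m. real m powr (- 1/2 + q)) \<and>
      (\<forall>\<^sub>F m in sequentially. \<forall>\<epsilon>. 0 < \<epsilon> \<and> \<epsilon> < 1 \<longrightarrow>
        (\<forall>I. is_epoch_complexity (R m) m \<epsilon> I \<longleftrightarrow>
             I = (1 + \<delta> m) * (1 / a) * ln (1 / \<epsilon>)))"
proof -
  obtain K where K: "\<forall>\<^sub>F m in sequentially. norm (R m - (1 - 1 / real m * a)) \<le> K * norm (real m powr (q - 3/2))"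
    using R by (elim landau_o.bigE)
  define t where "t m = - real m * ln (R m)" for m
  define \<delta> where "\<delta> m = a / t m - 1" for m
  have "(\<lambda>m. K * real m powr (q - 1/2)) \<longlonglongrightarrow> K * 0"
    using q by (intro tendsto_mult tendsto_const tendsto_neg_powr filterlim_real_sequentially) auto
  then have small: "\<forall>\<^sub>F m in sequentially. K * real m powr (q - 1/2) < a / 2"
    using a by (intro order_tendstoD(2)) auto
  have key: "\<forall>\<^sub>F m in sequentially. 0 < t m \<and> \<bar>\<delta> m\<bar> \<le> (2 / a * (K + 9 * a\<^sup>2 / 2)) * real m powr (q - 1/2)"
    using K small eventually_ge_at_top[of 1] eventually_ge_at_top[of "nat \<lceil>3 * a\<rceil>"]
  proof eventually_elim
    case (elim m)
    have m: "1 \<le> real m" using elim by simp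
    have ma: "3 * a \<le> m" using elim(4) by linarith
    define D where "D = m * (R m - (1 - 1 / real m * a))"
    define u where "u = 1 - R m"
    have mu: "m * u = a - D" using m by (simp add: D_def u_def field_simps)
    have "\<bar>D\<bar> \<le> m * (K * m powr (q - 3/2))"
      unfolding D_def abs_mult using elim(1) m by (intro mult_mono) auto
    also have "real m powr 1 * real m powr (q - 3/2) = real m powr (q - 1/2)"
      unfolding powr_add[symmetric] by simp
    then have "m * (K * m powr (q - 3/2)) = K * m powr (q - 1/2)" using m by (simp add: mult_ac)
    finally have D: "\<bar>D\<bar> \<le> K * m powr (q - 1/2)" .
    with elim(2) have mu_bounds: "a / 2 \<le> m * u" "m * u \<le> 3 * a / 2" using mu by linarith+
    have u0: "0 < u" using mu_bounds(1) a m by (smt (verit) mult_nonneg_nonpos divide_pos_pos)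
    have "m * u \<le> m * (1 / 2)" using mu_bounds(2) ma by linarith
    then have u1: "u \<le> 1 / 2" using m by (simp add: mult_le_cancel_left_pos)
    have Ru: "R m = 1 - u" by (simp add: u_def)
    have "u \<le> - ln (R m)" "- ln (R m) \<le> u + 2 * u\<^sup>2"
      using ln_one_minus_pos_lower_bound[of u] ln_one_minus_pos_upper_bound[of u] u0 u1 unfolding Ru by auto
    from this[THEN mult_left_mono, of "real m"] m
    have t: "m * u \<le> t m" "t m \<le> m * u + 2 * (m * u\<^sup>2)" by (auto simp: t_def distrib_left)
    have "m * u\<^sup>2 = (m * u)\<^sup>2 / m" using m by (simp add: power2_eq_square)
    also have "\<dots> \<le> (3 * a / 2)\<^sup>2 / m"
      using mu_bounds a m by (intro divide_right_mono power_mono) auto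
    also have "\<dots> = 9 * a\<^sup>2 / 4 * m powr (-1)" using m by (simp add: powr_minus_divide power2_eq_square)
    also have "\<dots> \<le> 9 * a\<^sup>2 / 4 * m powr (q - 1/2)" using m q by (intro mult_left_mono powr_mono) auto
    finally have mu2: "m * u\<^sup>2 \<le> 9 * a\<^sup>2 / 4 * m powr (q - 1/2)" .
    have "0 \<le> m * u\<^sup>2" by simp
    with t mu D mu2 have num: "\<bar>a - t m\<bar> \<le> (K + 9 * a\<^sup>2 / 2) * m powr (q - 1/2)"
      unfolding distrib_right by linarith
    have tp: "a / 2 \<le> t m" using t mu_bounds by linarith
    with a have t0: "0 < t m" by linarith
    have "\<bar>\<delta> m\<bar> = \<bar>a - t m\<bar> / t m" using t0 by (simp add: \<delta>_def abs_if field_simps)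
    also have "\<dots> \<le> \<bar>a - t m\<bar> / (a / 2)" using tp a by (intro divide_left_mono) auto
    also have "\<dots> = 2 / a * \<bar>a - t m\<bar>" using a by simp
    also have "\<dots> \<le> 2 / a * ((K + 9 * a\<^sup>2 / 2) * m powr (q - 1/2))"
      using a by (intro mult_left_mono num) auto
    finally show ?case using t0 by (auto simp only: mult.assoc)
  qed
  define C where "C = 2 / a * (K + 9 * a\<^sup>2 / 2)"
  have "\<delta> \<in> O(\<lambda>m. real m powr (- 1/2 + q))"
  proof (rule landau_o.bigI)
    show "0 < max 1 C" by simp
    show "\<forall>\<^sub>F m in sequentially. norm (\<delta> m) \<le> max 1 C * norm (real m powr (- 1/2 + q))"
      using key unfolding C_def[symmetric]
    proof eventually_elim
      case (elim m)
      have "C * real m powr (q - 1/2) \<le> max 1 C * real m powr (q - 1/2)"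
        by (intro mult_right_mono) auto
      with elim have "\<bar>\<delta> m\<bar> \<le> max 1 C * real m powr (q - 1/2)" by linarith
      moreover have "- 1/2 + q = q - 1/2" by simp
      ultimately show ?case by (simp only: real_norm_def abs_of_nonneg powr_ge_zero)
    qed
  qed
  moreover have "\<forall>\<^sub>F m in sequentially. \<forall>\<epsilon>. 0 < \<epsilon> \<and> \<epsilon> < 1 \<longrightarrow>
        (\<forall>I. is_epoch_complexity (R m) m \<epsilon> I \<longleftrightarrow> I = (1 + \<delta> m) * (1 / a) * ln (1 / \<epsilon>))"
    using key eventually_ge_at_top[of 1]
  proof eventually_elim
    case (elim m)
    show ?case
    proof (intro allI impI)
      fix \<epsilon> I :: real assume \<epsilon>: "0 < \<epsilon> \<and> \<epsilon> < 1"
      have R0: "0 < R m" using R_pos elim by simp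
      have t0: "0 < t m" using elim by simp
      have "is_epoch_complexity (R m) m \<epsilon> I \<longleftrightarrow> exp (real m * I * ln (R m)) = exp (ln \<epsilon>)"
        using R0 \<epsilon> by (simp add: is_epoch_complexity_def powr_def)
      also have "\<dots> \<longleftrightarrow> t m * I = ln (1 / \<epsilon>)"
        using \<epsilon> by (auto simp: t_def ln_div algebra_simps)
      also have "\<dots> \<longleftrightarrow> I = (1 + \<delta> m) * (1 / a) * ln (1 / \<epsilon>)"
        using t0 a by (auto simp: \<delta>_def field_simps)
      finally show "is_epoch_complexity (R m) m \<epsilon> I \<longleftrightarrow> I = (1 + \<delta> m) * (1 / a) * ln (1 / \<epsilon>)" .
    qed
  qed
  ultimately show ?thesis by blast
qed

text \<open>The difference is \<open>(1 - r\<^sup>2) / m\<close> times the sum of three terms: the loss \<open>1 - e\<close> of the step size, the reserved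
fraction \<open>e / m\<close>, and the delay term, of order \<open>(M1 + M2) / sqrt m\<close>, \<open>1 / m\<close> and \<open>M1 / sqrt m\<close>.\<close>

lemma arock_rate_asymptotics:
  fixes M1 M2 e :: "nat \<Rightarrow> real"
  assumes r: "0 < r" "r < 1" and q: "0 \<le> q"
    and nonneg: "\<And>m. 1 \<le> m \<Longrightarrow> 0 \<le> M1 m" "\<And>m. 1 \<le> m \<Longrightarrow> 0 \<le> M2 m"
    and e: "\<And>m. 1 \<le> m \<Longrightarrow> e m = inverse (1 + (sqrt (1 - r\<^sup>2) * M1 m + 2 * M2 m) / sqrt m)"
    and M1: "M1 \<in> O(\<lambda>m. real m powr q)" and M2: "M2 \<in> O(\<lambda>m. real m powr q)"
  shows "(\<lambda>m. arock_rate m r (e m) (M1 m) - serial_rate m r) \<in> O(\<lambda>m. real m powr (q - 3/2))"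
proof -
  have "(\<lambda>m. M1 m + M2 m) \<in> O(\<lambda>m. real m powr q)" using M1 M2 by (rule sum_in_bigo)
  then obtain K where K: "K > 0" "\<forall>\<^sub>F m in sequentially. norm (M1 m + M2 m) \<le> K * norm (real m powr q)"
    by (elim landau_o.bigE)
  define A where "A = sqrt (1 - r\<^sup>2)"
  have a: "0 \<le> 1 - r\<^sup>2" "1 - r\<^sup>2 \<le> 1" using r by (auto simp: power_le_one)
  have A: "0 \<le> A" "A \<le> 1" using a by (auto simp: A_def)
  have "\<forall>\<^sub>F m in sequentially. norm (arock_rate m r (e m) (M1 m) - (serial_rate m r))
      \<le> (2 * K + 1) * norm (real m powr (q - 3/2))"
    using K(2) eventually_ge_at_top[of 1]
  proof eventually_elim
    case (elim m)
    have m: "1 \<le> real m" using elim by simp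
    define s where "s = sqrt (real m)"
    have s: "0 < s" using m by (simp add: s_def)
    note n = nonneg[OF elim(2)]
    define \<theta> where "\<theta> = (A * M1 m + 2 * M2 m) / s"
    have \<theta>: "0 \<le> \<theta>" using n A s by (simp add: \<theta>_def)
    have e_eq: "e m = inverse (1 + \<theta>)" using e[OF elim(2)] by (simp add: \<theta>_def A_def s_def)
    have e01: "0 < e m" "e m \<le> 1" using \<theta> by (auto simp: e_eq inverse_le_1_iff)
    have "1 - e m = e m * \<theta>" using \<theta> by (simp add: e_eq field_simps)
    also have "\<dots> \<le> 1 * \<theta>" using e01 \<theta> by (intro mult_right_mono) auto
    finally have e1: "1 - e m \<le> \<theta>" by simp
    have AM: "A * M1 m \<le> 1 * M1 m" using A n by (intro mult_right_mono) auto
    define z where "z = e m * (e m * (A / s * M1 m))"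
    have z0: "0 \<le> A / s * M1 m" using A s n by simp
    have "0 \<le> e m * y" "e m * y \<le> y" if "0 \<le> y" for y
      using e01 that by (auto intro: mult_left_le_one_le)
    from this[OF z0] this[OF this(1)[OF z0]]
    have z: "0 \<le> z" "z \<le> A / s * M1 m" unfolding z_def by linarith+
    have diff: "arock_rate m r (e m) (M1 m) - (serial_rate m r)
        = (1 - r\<^sup>2) / m * (1 - e m + e m / m + z)"
      unfolding arock_rate_def z_def A_def[symmetric] s_def[symmetric] using m s by (simp add: field_simps)
    have em: "0 \<le> e m / m" "e m / m \<le> 1 / m" using e01 m by (auto simp: divide_right_mono)
    have pos: "0 \<le> 1 - e m + e m / m + z" using e01 em z by linarith
    have "norm (arock_rate m r (e m) (M1 m) - (serial_rate m r))
        = (1 - r\<^sup>2) / m * (1 - e m + e m / m + z)"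
      unfolding diff using pos a by simp
    also have "\<dots> \<le> 1 / m * (\<theta> + 1 / m + A * M1 m / s)"
      using e1 em z pos a by (intro mult_mono divide_right_mono) auto
    also have "\<dots> \<le> 1 / m * (2 * (M1 m + M2 m) / s + 1 / m)"
    proof (rule mult_left_mono)
      have "\<theta> + A * M1 m / s = (2 * (A * M1 m) + 2 * M2 m) / s"
        by (simp add: \<theta>_def add_divide_distrib[symmetric])
      also have "\<dots> \<le> 2 * (M1 m + M2 m) / s" using AM s by (intro divide_right_mono) auto
      finally show "\<theta> + 1 / m + A * M1 m / s \<le> 2 * (M1 m + M2 m) / s + 1 / m" by simp
    qed simp
    also have "\<dots> \<le> 1 / m * (2 * (K * m powr q) / s + m powr (q - 1/2))"
    proof (intro mult_left_mono add_mono divide_right_mono)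
      show "M1 m + M2 m \<le> K * real m powr q" using elim(1) n by simp
      have "m powr (-1) \<le> m powr (q - 1/2)" using m q by (intro powr_mono) auto
      then show "1 / m \<le> m powr (q - 1/2)" using m by (simp add: powr_minus_divide)
    qed (use s in auto)
    also have "\<dots> = 1 / m * (2 * K * (m powr q / s) + m powr (q - 1/2))" by simp
    also have "m powr q / s = m powr (q - 1/2)"
      using m unfolding s_def by (simp add: powr_diff powr_half_sqrt)
    also have "1 / m * (2 * K * m powr (q - 1/2) + m powr (q - 1/2)) = (2 * K + 1) * (1 / m * m powr (q - 1/2))"
      by (simp add: field_simps)
    also have "1 / m * m powr (q - 1/2) = m powr (q - 3/2)"
    proof -
      have "m powr (-1 + (q - 1/2)) = 1 / m * m powr (q - 1/2)"
        using m unfolding powr_add by (simp add: powr_minus_divide)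
      moreover have "-1 + (q - 1/2) = q - 3/2" by simp
      ultimately show ?thesis by simp
    qed
    finally show ?case by simp
  qed
  then show ?thesis by (rule landau_o.bigI[rotated]) (use K in simp)
qed

theorem theorem1:
  fixes r q :: real
    and M :: "nat \<Rightarrow> 'w measure"
    and H :: "nat \<Rightarrow> 'a::{real_inner, banach, second_countable_topology} set"
    and B :: "nat \<Rightarrow> nat \<Rightarrow> 'a set"
    and T :: "nat \<Rightarrow> 'a \<Rightarrow> 'a"
    and xs :: "nat \<Rightarrow> 'a"
    and i :: "nat \<Rightarrow> nat \<Rightarrow> 'w \<Rightarrow> nat"
    and j :: "nat \<Rightarrow> nat \<Rightarrow> nat \<Rightarrow> 'w \<Rightarrow> nat"
    and x :: "nat \<Rightarrow> nat \<Rightarrow> 'w \<Rightarrow> 'a"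
    and P :: "nat \<Rightarrow> nat \<Rightarrow> real"
    and \<rho> M1 M2 \<eta>1 :: "nat \<Rightarrow> real"
  assumes "0 < r" and "r < 1" and "0 \<le> q" and "q < 1/2"
    and instances: "\<And>m. 1 \<le> m \<Longrightarrow>
      arock_iid (M m) m (H m) (B m) r (T m) (xs m) (\<lambda>k. \<eta>1 m) (i m) (j m) (x m)"
    and P_eq: "\<And>m k l. 1 \<le> m \<Longrightarrow>
      P m l = measure (M m) {\<omega> \<in> space (M m). l \<le> current_delay m (j m) k \<omega>}"
    and \<rho>_eq: "\<And>m. \<rho> m = 1 - 1 / real m * (1 - r\<^sup>2)"
    and M1_finite: "\<And>m. 1 \<le> m \<Longrightarrow>
      summable (\<lambda>l. P m (Suc l) * \<rho> m powr (- real (Suc l) / 2))"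
    and M1_eq: "\<And>m. M1 m = (\<Sum>l. P m (Suc l) * \<rho> m powr (- real (Suc l) / 2))"
    and M2_finite: "\<And>m. 1 \<le> m \<Longrightarrow>
      summable (\<lambda>l. sqrt (P m (Suc l)) * \<rho> m powr (- real (Suc l) / 2))"
    and M2_eq: "\<And>m. M2 m = (\<Sum>l. sqrt (P m (Suc l)) * \<rho> m powr (- real (Suc l) / 2))"
    and M1_bigo: "M1 \<in> O(\<lambda>m. real m powr q)"
    and M2_bigo: "M2 \<in> O(\<lambda>m. real m powr q)"
    and \<eta>1_eq: "\<And>m. \<eta>1 m = inverse (1 + real m powr (- 1/2) * (sqrt (1 - r\<^sup>2) * M1 m + 2 * M2 m))"
  shows "\<exists>(c :: nat \<Rightarrow> nat \<Rightarrow> real) (R :: nat \<Rightarrow> real).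
    (\<forall>m\<ge>1. \<forall>l\<ge>1. 0 < c m l) \<and>
    (\<forall>m\<ge>1. 0 < R m) \<and>
    (\<forall>m\<ge>1. \<forall>k. AE \<omega> in M m.
        nn_cond_exp (M m) (G_filtration (M m) (x m) k)
          (\<lambda>\<omega>. ennreal (lyapunov m (c m) (xs m) (\<lambda>n. x m n \<omega>) (Suc k))) \<omega>
        \<le> ennreal (R m * lyapunov m (c m) (xs m) (\<lambda>n. x m n \<omega>) k)) \<and>
    (\<lambda>m. R m - (1 - 1 / real m * (1 - r\<^sup>2))) \<in> O(\<lambda>m. real m powr (q - 3/2)) \<and>
    (\<exists>\<delta> :: nat \<Rightarrow> real. \<delta> \<in> O(\<lambda>m. real m powr (- 1/2 + q)) \<and>
      (\<forall>\<^sub>F m in sequentially. \<forall>\<epsilon>. 0 < \<epsilon> \<and> \<epsilon> < 1 \<longrightarrow>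
        (\<forall>I. is_epoch_complexity (R m) m \<epsilon> I \<longleftrightarrow>
             I = (1 + \<delta> m) * (1 / (1 - r\<^sup>2)) * ln (1 / \<epsilon>))))"
proof -
  note r = \<open>0 < r\<close> \<open>r < 1\<close> and q = \<open>0 \<le> q\<close> \<open>q < 1/2\<close>
  define c where "c m = lyapunov_coeff m r (P m)" for m
  define R where "R m = arock_rate m r (\<eta>1 m) (M1 m)" for m
  have M1: "(\<lambda>l. P m (Suc l) * (1 - 1 / real m * (1 - r\<^sup>2)) powr (- real (Suc l) / 2)) sums M1 m" if "1 \<le> m" for m
    using summable_sums[OF M1_finite[OF that]] unfolding M1_eq \<rho>_eq .
  have M2: "(\<lambda>l. sqrt (P m (Suc l)) * (1 - 1 / real m * (1 - r\<^sup>2)) powr (- real (Suc l) / 2)) sums M2 m" if "1 \<le> m" for m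
    using summable_sums[OF M2_finite[OF that]] unfolding M2_eq \<rho>_eq .
  have P0: "0 \<le> P m l" if "1 \<le> m" for m l
    unfolding P_eq[OF that, of l 0] by simp
  have M10: "0 \<le> M1 m" and M20: "0 \<le> M2 m" if "1 \<le> m" for m
    using M1_nonneg[OF r that P0[OF that] M1[OF that] M2[OF that]]
      M2_nonneg[OF r that P0[OF that] M1[OF that] M2[OF that]] by auto
  have \<eta>: "\<eta>1 m = inverse (1 + (sqrt (1 - r\<^sup>2) * M1 m + 2 * M2 m) / sqrt m)" if "1 \<le> m" for m
    using that unfolding \<eta>1_eq by (simp add: powr_minus_divide powr_half_sqrt)
  have \<eta>01: "0 \<le> \<eta>1 m" "\<eta>1 m \<le> 1" if "1 \<le> m" for m
  proof -
    have "0 \<le> (sqrt (1 - r\<^sup>2) * M1 m + 2 * M2 m) / sqrt m"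
      using M10[OF that] M20[OF that] r by (simp add: power_le_one)
    then show "0 \<le> \<eta>1 m" "\<eta>1 m \<le> 1" unfolding \<eta>[OF that] by (auto simp: inverse_le_1_iff)
  qed
  have c_pos: "0 < c m l" if "1 \<le> m" "1 \<le> l" for m l
    unfolding c_def by (rule lyapunov_coeff_pos[OF r that(1) P0 M1 M2 that(2)]) (rule that(1))+
  have R_pos: "0 < R m" if "1 \<le> m" for m
    unfolding R_def using serial_rate_pos[OF r that] arock_rate_ge[OF r that \<eta>01[OF that] M10[OF that]] by linarith
  have contraction: "AE \<omega> in M m.
        nn_cond_exp (M m) (G_filtration (M m) (x m) k)
          (\<lambda>\<omega>. ennreal (lyapunov m (c m) (xs m) (\<lambda>n. x m n \<omega>) (Suc k))) \<omega>
        \<le> ennreal (R m * lyapunov m (c m) (xs m) (\<lambda>n. x m n \<omega>) k)" if "1 \<le> m" for m k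
    unfolding c_def R_def
    by (rule arock_iid.nn_cond_exp_lyapunov_le_rate[OF instances[OF that] refl \<eta>[OF that] P_eq[OF that] M1[OF that] M2[OF that]])
  have rate: "(\<lambda>m. R m - (1 - 1 / real m * (1 - r\<^sup>2))) \<in> O(\<lambda>m. real m powr (q - 3/2))"
    unfolding R_def by (rule arock_rate_asymptotics[OF r q(1) M10 M20 \<eta> M1_bigo M2_bigo])
  have "0 < 1 - r\<^sup>2" using r by (simp add: power_less_one_iff)
  from epoch_complexity_asymptotics[OF this q R_pos rate]
  show ?thesis using c_pos R_pos contraction rate by blast
qed

end
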